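(* Let $(x_i,y_i)$, $i=1,\dots,n$, be data with $x_i\in\mathbb R^d$, let $\lambda$ be a regularization parameter, and let $$F(w)=\frac1n\sum_{i=1}^n\ell(w^\top x_i,y_i)+\lambda R(w),\qquad w\in\mathbb R^d,$$ where the loss function $\ell(z,y)$ is (convex) piecewise linear and $R$ is the $\ell_1$, $\ell_\infty$ or $\ell_{1,\infty}$ norm. Then the problem of minimizing $F$ over $\mathbb R^d$ satisfies the local growth condition with $\theta=1$: for any $\epsilon>0$ there is a constant $0<c<\infty$ such that $$\|w-w_*\|_2\le c\,(F(w)-F_* )\qquad\text{for all } w\in\mathcal S_\epsilon .$$ Hence ASSG can have an iteration complexity of $O\big(\log(1/\delta)\,\log(\epsilon_0/\epsilon)\big)$ with high probability $1-\delta$.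
   Context: $F_*=\min_{w\in\mathbb R^d}F(w)$ (the set of minimizers is nonempty), $w_*$ is the minimizer of $F$ closest to $w$, and $\mathcal S_\epsilon=\{w\in\mathbb R^d:F(w)\le F_*+\epsilon\}$. $\|w\|_{1,\infty}$ is the sum over the blocks of a fixed partition of the coordinates of the maximal absolute value within the block. ASSG (accelerated stochastic subgradient method; described here in its constrained variant) is applied to the stochastic problem $F(w)=\mathbb E_\xi[f(w;\xi)]$ with $f(\cdot;\xi)$ convex, for instance $\xi=i$ uniform on $\{1,\dots,n\}$ and $f(w;i)=\ell(w^\top x_i,y_i)+\lambda R(w)$, where $G$ is a bound on the norms of the subgradients $\partial f(w;\xi)$. Inputs: $w_0$ with $F(w_0)-F_*\le\epsilon_0$, a target accuracy $\epsilon\ll1$, $\delta\in(0,1)$, $K=\lceil\log_2(\epsilon_0/\epsilon)\rceil$, $\tilde\delta=\delta/K$, $D_1\ge c\epsilon_0/\epsilon^{1-\theta}$ with $D_1=O(c\epsilon_0/\epsilon^{1-\theta})$ (here $\theta=1$), $t$ the smallest integer with $t\ge\max\{9,1728\log(1/\tilde\delta)\}G^2D_1^2/\epsilon_0^2$, $\eta_1=\epsilon_0/(3G^2)$. For $k=1,\dots,K$: $w^k_1=w_{k-1}$; for $\tau=1,\dots,t-1$, $w^k_{\tau+1}$ is the Euclidean projection of $w^k_\tau-\eta_k\partial f(w^k_\tau;\xi^k_\tau)$ onto the ball of radius $D_k$ centred at $w_{k-1}$, with $\xi^k_\tau$ independent samples of $\xi$; $w_k=\frac1t\sum_{\tau=1}^tw^k_\tau$,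 $\eta_{k+1}=\eta_k/2$, $D_{k+1}=D_k/2$. The output is $w_K$. The iteration complexity is the number of iterations used to obtain a point $w$ with $F(w)-F_*\le2\epsilon$.
   Formalization: As t grows with log(K/δ), the stated bound fails for fixed δ as ε→0. Proved, for ε≤ε_0/2 and δ≤1/2: O(log(K/δ)log(ε_0/ε)) iterations always, and O(log(1/δ)log(ε_0/ε)) whenever log K ≤ a·log(1/δ), for any fixed a. *)

theory Defs
  imports "HOL-Probability.Probability" "HOL-Library.Disjoint_Sets"
begin

text \<open>A function is piecewise linear if its domain is covered by finitely many polyhedral sets
  on each of which the function is affine.\<close>

definition piecewise_linear :: "('a::euclidean_space \<Rightarrow> real) \<Rightarrow> bool" where
  "piecewise_linear h \<longleftrightarrow>
     (\<exists>\<P>. finite \<P> \<and> \<Union>\<P> = UNIV \<and>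
          (\<forall>P\<in>\<P>. polyhedron P \<and> (\<exists>a b. \<forall>z\<in>P. h z = a \<bullet> z + b)))"

definition l1_norm :: "real ^ 'd \<Rightarrow> real" where
  "l1_norm w = (\<Sum>j\<in>UNIV. \<bar>w $ j\<bar>)"

definition l1inf_norm :: "'d set set \<Rightarrow> real ^ 'd \<Rightarrow> real" where
  "l1inf_norm \<B> w = (\<Sum>B\<in>\<B>. Max ((\<lambda>j. \<bar>w $ j\<bar>) ` B))"

text \<open>The maximum norm is the library's \<^const>\<open>infnorm\<close>.\<close>

definition regularized_risk ::
  "nat \<Rightarrow> (nat \<Rightarrow> 'a::euclidean_space) \<Rightarrow> (nat \<Rightarrow> 'y) \<Rightarrow> (real \<Rightarrow> 'y \<Rightarrow> real) \<Rightarrow> real \<Rightarrow> ('a \<Rightarrow> real) \<Rightarrow> 'a \<Rightarrow> real"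
  where
  "regularized_risk n x y loss reg R w = (1 / real n) * (\<Sum>i=1..n. loss (w \<bullet> x i) (y i)) + reg * R w"

definition minimizers :: "('a \<Rightarrow> real) \<Rightarrow> 'a set" where
  "minimizers F = {w. is_arg_min F (\<lambda>_. True) w}"

definition min_value :: "('a \<Rightarrow> real) \<Rightarrow> real" where
  "min_value F = (INF w. F w)"

definition sublevel :: "('a \<Rightarrow> real) \<Rightarrow> real \<Rightarrow> 'a set" where
  "sublevel F \<epsilon> = {w. F w \<le> min_value F + \<epsilon>}"

definition local_growth :: "('a::euclidean_space \<Rightarrow> real) \<Rightarrow> real \<Rightarrow> real \<Rightarrow> real \<Rightarrow> bool" where
  "local_growth F \<theta> c \<epsilon> \<longleftrightarrow>
     (\<forall>w\<in>sublevel F \<epsilon>.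
        norm (w - closest_point (minimizers F) w) \<le> c * (F w - min_value F) powr \<theta>)"

definition subdifferential :: "('a::real_inner \<Rightarrow> real) \<Rightarrow> 'a \<Rightarrow> 'a set" where
  "subdifferential h w = {v. \<forall>u. h u \<ge> h w + v \<bullet> (u - w)}"

text \<open>\<open>stochastic_problem M f g F G\<close>: \<open>M\<close> is the law of the random variable \<open>\<xi>\<close>,
  \<open>F w = E f(w;\<xi>)\<close> with \<open>f\<close> convex in \<open>w\<close>, \<open>g w s\<close> is the subgradient of \<open>f(\<cdot>;s)\<close> at \<open>w\<close> used
  by the algorithm, and \<open>G\<close> bounds the norms of all subgradients. The iterates must be random
  variables, so \<open>g\<close> is taken jointly measurable; no such condition is imposed when \<open>\<xi>\<close> takes
  values in a countable discrete space, where the iterates are measurable for every choice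
  of the subgradients.\<close>

definition stochastic_problem ::
  "'b measure \<Rightarrow> ('a::euclidean_space \<Rightarrow> 'b \<Rightarrow> real) \<Rightarrow> ('a \<Rightarrow> 'b \<Rightarrow> 'a) \<Rightarrow> ('a \<Rightarrow> real) \<Rightarrow> real \<Rightarrow> bool"
  where
  "stochastic_problem M f g F G \<longleftrightarrow>
     prob_space M \<and>
     (\<forall>s\<in>space M. convex_on UNIV (\<lambda>w. f w s)) \<and>
     (\<forall>w. integrable M (f w) \<and> F w = integral\<^sup>L M (f w)) \<and>
     (\<forall>w. \<forall>s\<in>space M. g w s \<in> subdifferential (\<lambda>u. f u s) w) \<and>
     (\<forall>w. \<forall>s\<in>space M. \<forall>v\<in>subdifferential (\<lambda>u. f u s) w. norm v \<le> G) \<and>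
     ((\<lambda>(w, s). g w s) \<in> borel_measurable (borel \<Otimes>\<^sub>M M) \<or>
      (countable (space M) \<and> sets M = Pow (space M)))"

text \<open>Projected stochastic subgradient steps on the ball of radius \<open>D\<close> around \<open>v\<close>.
  The first iterate \<open>w\<^sub>1 = v\<close> has index \<open>0\<close> here, i.e. \<open>ssg_iterate \<dots> j\<close> is \<open>w\<close> with index \<open>j + 1\<close>;
  the samples \<open>\<zeta>\<close> are indexed from \<open>1\<close>.\<close>

primrec ssg_iterate ::
  "('a::euclidean_space \<Rightarrow> 'b \<Rightarrow> 'a) \<Rightarrow> real \<Rightarrow> real \<Rightarrow> 'a \<Rightarrow> (nat \<Rightarrow> 'b) \<Rightarrow> nat \<Rightarrow> 'a" where
  "ssg_iterate g \<eta> D v \<zeta> 0 = v"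
| "ssg_iterate g \<eta> D v \<zeta> (Suc j) =
     closest_point (cball v D)
       (ssg_iterate g \<eta> D v \<zeta> j - \<eta> *\<^sub>R g (ssg_iterate g \<eta> D v \<zeta> j) (\<zeta> (Suc j)))"

definition ssg_average ::
  "('a::euclidean_space \<Rightarrow> 'b \<Rightarrow> 'a) \<Rightarrow> nat \<Rightarrow> real \<Rightarrow> real \<Rightarrow> 'a \<Rightarrow> (nat \<Rightarrow> 'b) \<Rightarrow> 'a" where
  "ssg_average g t \<eta> D v \<zeta> = (1 / real t) *\<^sub>R (\<Sum>j<t. ssg_iterate g \<eta> D v \<zeta> j)"

text \<open>\<open>assg_stage \<dots> k\<close> is \<open>w\<^sub>k\<close>; stage \<open>Suc k\<close> uses step size \<open>\<eta>1 / 2^k\<close>, radius \<open>D1 / 2^k\<close>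
  and the samples \<open>\<xi> (Suc k)\<close>.\<close>

primrec assg_stage ::
  "('a::euclidean_space \<Rightarrow> 'b \<Rightarrow> 'a) \<Rightarrow> nat \<Rightarrow> real \<Rightarrow> real \<Rightarrow> 'a \<Rightarrow> (nat \<Rightarrow> nat \<Rightarrow> 'b) \<Rightarrow> nat \<Rightarrow> 'a" where
  "assg_stage g t \<eta>1 D1 w0 \<xi> 0 = w0"
| "assg_stage g t \<eta>1 D1 w0 \<xi> (Suc k) =
     ssg_average g t (\<eta>1 / 2 ^ k) (D1 / 2 ^ k) (assg_stage g t \<eta>1 D1 w0 \<xi> k) (\<xi> (Suc k))"

definition assg_K :: "real \<Rightarrow> real \<Rightarrow> nat" where
  "assg_K \<epsilon>0 \<epsilon> = nat \<lceil>log 2 (\<epsilon>0 / \<epsilon>)\<rceil>"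

definition assg_delta :: "real \<Rightarrow> real \<Rightarrow> real \<Rightarrow> real" where
  "assg_delta \<epsilon>0 \<epsilon> \<delta> = \<delta> / real (assg_K \<epsilon>0 \<epsilon>)"

definition assg_t :: "real \<Rightarrow> real \<Rightarrow> real \<Rightarrow> real \<Rightarrow> real \<Rightarrow> nat" where
  "assg_t G \<epsilon>0 \<epsilon> \<delta> D1 =
     nat \<lceil>max 9 (1728 * ln (1 / assg_delta \<epsilon>0 \<epsilon> \<delta>)) * G\<^sup>2 * D1\<^sup>2 / \<epsilon>0\<^sup>2\<rceil>"

definition assg_output ::
  "('a::euclidean_space \<Rightarrow> 'b \<Rightarrow> 'a) \<Rightarrow> real \<Rightarrow> real \<Rightarrow> real \<Rightarrow> real \<Rightarrow> real \<Rightarrow> 'a \<Rightarrow> (nat \<Rightarrow> nat \<Rightarrow> 'b) \<Rightarrow> 'a"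
  where
  "assg_output g G \<epsilon>0 \<epsilon> \<delta> D1 w0 \<xi> =
     assg_stage g (assg_t G \<epsilon>0 \<epsilon> \<delta> D1) (\<epsilon>0 / (3 * G\<^sup>2)) D1 w0 \<xi> (assg_K \<epsilon>0 \<epsilon>)"

definition assg_iterations :: "real \<Rightarrow> real \<Rightarrow> real \<Rightarrow> real \<Rightarrow> real \<Rightarrow> nat" where
  "assg_iterations G \<epsilon>0 \<epsilon> \<delta> D1 = assg_K \<epsilon>0 \<epsilon> * assg_t G \<epsilon>0 \<epsilon> \<delta> D1"

text \<open>The samples \<open>\<xi> k \<tau>\<close> with \<open>1 \<le> k \<le> K\<close> and \<open>1 \<le> \<tau> \<le> t - 1\<close> are independent with law \<open>M\<close>.\<close>

definition iid_samples ::
  "'c measure \<Rightarrow> 'b measure \<Rightarrow> nat \<Rightarrow> nat \<Rightarrow> (nat \<Rightarrow> nat \<Rightarrow> 'c \<Rightarrow> 'b) \<Rightarrow> bool" where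
  "iid_samples \<Omega> M K t \<xi> \<longleftrightarrow>
     prob_space \<Omega> \<and>
     prob_space.indep_vars \<Omega> (\<lambda>_. M) (\<lambda>(k, \<tau>). \<xi> k \<tau>) ({1..K} \<times> {1..<t}) \<and>
     (\<forall>k\<in>{1..K}. \<forall>\<tau>\<in>{1..<t}. distr \<Omega> M (\<xi> k \<tau>) = M)"

text \<open>ASSG with the given parameters, run on any stochastic problem for \<open>F\<close> with subgradient bound
  \<open>G\<close>, from any starting point \<open>w0\<close> with \<open>F w0 - F\<^sub>* \<le> \<epsilon>0\<close>, returns a \<open>2\<epsilon>\<close>-optimal point with
  probability at least \<open>1 - \<delta>\<close>. The type arguments only fix the value space of \<open>\<xi>\<close> and the
  underlying sample space.\<close>

definition assg_succeeds ::
  "'b itself \<Rightarrow> 'c itself \<Rightarrow> ('a::euclidean_space \<Rightarrow> real) \<Rightarrow> real \<Rightarrow> real \<Rightarrow> real \<Rightarrow> real \<Rightarrow> real \<Rightarrow> bool"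
  where
  "assg_succeeds (_ :: 'b itself) (_ :: 'c itself) F G \<epsilon>0 \<epsilon> \<delta> D1 \<longleftrightarrow>
     (\<forall>(M :: 'b measure) f g (\<Omega> :: 'c measure) \<xi> w0.
        stochastic_problem M f g F G \<and>
        iid_samples \<Omega> M (assg_K \<epsilon>0 \<epsilon>) (assg_t G \<epsilon>0 \<epsilon> \<delta> D1) \<xi> \<and>
        F w0 - min_value F \<le> \<epsilon>0 \<longrightarrow>
        measure \<Omega> {\<omega>\<in>space \<Omega>.
          F (assg_output g G \<epsilon>0 \<epsilon> \<delta> D1 w0 (\<lambda>k \<tau>. \<xi> k \<tau> \<omega>)) - min_value F \<le> 2 * \<epsilon>} \<ge> 1 - \<delta>)"

end

theory Submission
  imports Defs
begin

text \<open>The loss terms and the three norms are maxima of finitely many affine functions, hence so is the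
  objective \<open>F\<close> (\<open>convex_piecewise_linear_imp_max_affine\<close> and the closure lemmas before it).
  For such an \<open>F\<close>, Hoffman's error bound holds globally: the distance to the set of minimizers is at
  most a constant times \<open>F w - F\<^sub>*\<close> (\<open>max_affine_growth\<close>). The reason is finiteness. Let \<open>p\<close> be the
  projection of \<open>w\<close> onto the minimizers. Which unit vectors are normal to the minimizers at \<open>p\<close>, and how
  fast \<open>F\<close> grows along them, depends only on which affine pieces are active at \<open>p\<close>. For each of the
  finitely many active sets the unit normals form a compact set on which the slope of \<open>F\<close> is positive.

  For the algorithm any local growth condition with exponent 1 suffices, because for a convex function
  it implies the global one with the same constant (\<open>local_growth_imp_global\<close>). So if \<open>F w\<^sub>k - F\<^sub>* \<le> e\<close>
  for \<open>e = \<epsilon>0 / 2^k\<close>, then the closest minimizer \<open>p\<close> to \<open>w\<^sub>k\<close> lies in the ball of radius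
  \<open>D = D1 / 2^k \<ge> c e\<close> to which the next stage is confined, and it can serve as the comparison point of
  the classical regret bound (\<open>ssg_average_regret\<close>):
  \<open>F w\<^sub>k\<^sub>+\<^sub>1 - F p \<le> \<eta> G\<^sup>2 / 2 + D\<^sup>2 / (2 \<eta> t) + (noise) / t\<close>. With \<open>\<eta> = e / (3 G\<^sup>2)\<close> and
  \<open>t \<ge> 9 G\<^sup>2 D\<^sup>2 / e\<^sup>2\<close> each of the first two terms is at most \<open>e / 6\<close>. If the third one is too, the
  stage halves the error (\<open>assg_stage_halving\<close>), and \<open>K\<close> stages bring it below \<open>\<epsilon>\<close>.

  The noise is a sum of martingale differences of the form
  \<open>(F w - F p) - (f w \<xi> - f p \<xi>)\<close>. Working with values of \<open>f\<close> rather than with subgradients means that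
  no expected subgradient has to be selected. Since \<open>f\<close> is \<open>G\<close>-Lipschitz and all iterates stay within
  \<open>2 D\<close> of \<open>p\<close>, Hoeffding's lemma applied to one sample after the other gives an Azuma bound
  (\<open>ssg_noise_mgf\<close>, \<open>ssg_noise_tail\<close>); the prescribed \<open>t\<close> makes the failure probability of a stage at
  most \<open>\<delta> / K\<close>, and a union bound over the stages finishes the argument (\<open>assg_high_probability\<close>).
  The iteration count is then arithmetic, because \<open>D1\<^sup>2 / \<epsilon>0\<^sup>2\<close> is bounded by a constant.\<close>

section \<open>Maxima of finitely many affine functions\<close>

text \<open>The finite set \<open>A\<close> lists slopes and offsets. Asking for minorants that are attained pointwise,
  instead of an equation with \<^const>\<open>Max\<close>, makes the closure properties below a matter of
  recombining these pairs.\<close>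

definition max_affine :: "('a::euclidean_space \<Rightarrow> real) \<Rightarrow> bool" where
  "max_affine h \<longleftrightarrow>
     (\<exists>A. finite A \<and> (\<forall>w. (\<forall>(a, b)\<in>A. a \<bullet> w + b \<le> h w) \<and> (\<exists>(a, b)\<in>A. h w = a \<bullet> w + b)))"

lemma max_affineI:
  assumes "finite A" "\<And>w a b. (a, b) \<in> A \<Longrightarrow> a \<bullet> w + b \<le> h w"
    "\<And>w. \<exists>a b. (a, b) \<in> A \<and> h w = a \<bullet> w + b"
  shows "max_affine h"
  unfolding max_affine_def using assms by (intro exI[of _ A]) fast

lemma max_affineE:
  assumes "max_affine h"
  obtains A where "finite A" "\<And>w a b. (a, b) \<in> A \<Longrightarrow> a \<bullet> w + b \<le> h w"
    "\<And>w. \<exists>a b. (a, b) \<in> A \<and> h w = a \<bullet> w + b"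
  using assms unfolding max_affine_def by fast

lemma max_affine_affine: "max_affine (\<lambda>w. a \<bullet> w + b)"
  by (rule max_affineI[of "{(a, b)}"]) auto

lemma max_affine_add:
  assumes "max_affine h" "max_affine k"
  shows "max_affine (\<lambda>w. h w + k w)"
proof -
  obtain A where A: "finite A" "\<And>w a b. (a, b) \<in> A \<Longrightarrow> a \<bullet> w + b \<le> h w"
    "\<And>w. \<exists>a b. (a, b) \<in> A \<and> h w = a \<bullet> w + b" by (metis max_affineE[OF assms(1)])
  obtain B where B: "finite B" "\<And>w a b. (a, b) \<in> B \<Longrightarrow> a \<bullet> w + b \<le> k w"
    "\<And>w. \<exists>a b. (a, b) \<in> B \<and> k w = a \<bullet> w + b" by (metis max_affineE[OF assms(2)])
  let ?S = "(\<lambda>(p, q). (fst p + fst q, snd p + snd q)) ` (A \<times> B)"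
  show ?thesis
  proof (rule max_affineI[of ?S])
    show "finite ?S" using A(1) B(1) by simp
  next
    fix w a b assume "(a, b) \<in> ?S"
    then obtain a1 b1 a2 b2 where "(a1, b1) \<in> A" "(a2, b2) \<in> B" "a = a1 + a2" "b = b1 + b2"
      by auto
    then show "a \<bullet> w + b \<le> h w + k w"
      using A(2)[of a1 b1 w] B(2)[of a2 b2 w] by (simp add: inner_add_left)
  next
    fix w
    obtain a1 b1 where 1: "(a1, b1) \<in> A" "h w = a1 \<bullet> w + b1" using A(3) by blast
    obtain a2 b2 where 2: "(a2, b2) \<in> B" "k w = a2 \<bullet> w + b2" using B(3) by blast
    have "(a1 + a2, b1 + b2) \<in> ?S" using 1(1) 2(1) by force
    moreover have "h w + k w = (a1 + a2) \<bullet> w + (b1 + b2)" using 1 2 by (simp add: inner_add_left)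
    ultimately show "\<exists>a b. (a, b) \<in> ?S \<and> h w + k w = a \<bullet> w + b" by blast
  qed
qed

lemma max_affine_scale:
  assumes "max_affine h" "0 \<le> c"
  shows "max_affine (\<lambda>w. c * h w)"
proof -
  obtain A where A: "finite A" "\<And>w a b. (a, b) \<in> A \<Longrightarrow> a \<bullet> w + b \<le> h w"
    "\<And>w. \<exists>a b. (a, b) \<in> A \<and> h w = a \<bullet> w + b" by (metis max_affineE[OF assms(1)])
  let ?S = "(\<lambda>(a, b). (c *\<^sub>R a, c * b)) ` A"
  show ?thesis
  proof (rule max_affineI[of ?S])
    show "finite ?S" using A(1) by simp
  next
    fix w a b assume "(a, b) \<in> ?S"
    then obtain a1 b1 where "(a1, b1) \<in> A" "a = c *\<^sub>R a1" "b = c * b1"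
      by auto
    then show "a \<bullet> w + b \<le> c * h w"
      using mult_left_mono[OF A(2)[of a1 b1 w] assms(2)] by (simp add: distrib_left)
  next
    fix w
    obtain a1 b1 where 1: "(a1, b1) \<in> A" "h w = a1 \<bullet> w + b1" using A(3) by blast
    have "(c *\<^sub>R a1, c * b1) \<in> ?S" using 1(1) by force
    moreover have "c * h w = (c *\<^sub>R a1) \<bullet> w + c * b1" using 1 by (simp add: distrib_left)
    ultimately show "\<exists>a b. (a, b) \<in> ?S \<and> c * h w = a \<bullet> w + b" by blast
  qed
qed

lemma max_affine_sum:
  assumes "\<And>i. i \<in> I \<Longrightarrow> max_affine (h i)"
  shows "max_affine (\<lambda>w. \<Sum>i\<in>I. h i w)"
  using assms
proof (induction I rule: infinite_finite_induct)
  case (insert i I)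
  then show ?case using max_affine_add[of "h i" "\<lambda>w. \<Sum>i\<in>I. h i w"] by simp
qed (use max_affine_affine[of 0 0] in simp_all)

lemma max_affine_Max:
  assumes "finite I" "I \<noteq> {}" "\<And>i. i \<in> I \<Longrightarrow> max_affine (h i)"
  shows "max_affine (\<lambda>w. Max ((\<lambda>i. h i w) ` I))"
proof -
  have "\<forall>i\<in>I. \<exists>A. finite A \<and> (\<forall>w a b. (a, b) \<in> A \<longrightarrow> a \<bullet> w + b \<le> h i w)
      \<and> (\<forall>w. \<exists>a b. (a, b) \<in> A \<and> h i w = a \<bullet> w + b)"
    using assms(3) by (metis max_affineE)
  then obtain A where A: "\<And>i. i \<in> I \<Longrightarrow> finite (A i)"
    "\<And>i w a b. i \<in> I \<Longrightarrow> (a, b) \<in> A i \<Longrightarrow> a \<bullet> w + b \<le> h i w"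
    "\<And>i w. i \<in> I \<Longrightarrow> \<exists>a b. (a, b) \<in> A i \<and> h i w = a \<bullet> w + b"
    by metis
  show ?thesis
  proof (rule max_affineI[of "\<Union>i\<in>I. A i"])
    show "finite (\<Union>i\<in>I. A i)" using assms(1) A(1) by simp
  next
    fix w a b assume "(a, b) \<in> (\<Union>i\<in>I. A i)"
    then obtain i where i: "i \<in> I" "(a, b) \<in> A i" by blast
    have "h i w \<le> Max ((\<lambda>i. h i w) ` I)" using assms(1) i(1) by simp
    with A(2)[OF i] show "a \<bullet> w + b \<le> Max ((\<lambda>i. h i w) ` I)" by (meson order_trans)
  next
    fix w
    have "Max ((\<lambda>i. h i w) ` I) \<in> (\<lambda>i. h i w) ` I" using assms(1,2) by (intro Max_in) auto
    then obtain i where i: "i \<in> I" "Max ((\<lambda>i. h i w) ` I) = h i w" by blast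
    with A(3)[OF i(1), of w]
    show "\<exists>a b. (a, b) \<in> (\<Union>i\<in>I. A i) \<and> Max ((\<lambda>i. h i w) ` I) = a \<bullet> w + b" by auto
  qed
qed

lemma max_affine_abs_inner: "max_affine (\<lambda>w. \<bar>w \<bullet> a\<bar>)"
proof (rule max_affineI[of "{(a, 0), (- a, 0)}"])
  fix w :: 'a
  show "\<exists>c b. (c, b) \<in> {(a, 0), (- a, 0)} \<and> \<bar>w \<bullet> a\<bar> = c \<bullet> w + b"
    by (cases "w \<bullet> a \<ge> 0") (force simp: inner_commute)+
qed (auto simp: inner_commute)

lemma max_affine_compose_inner:
  fixes h :: "real \<Rightarrow> real"
  assumes "max_affine h"
  shows "max_affine (\<lambda>w. h (w \<bullet> x))"
proof -
  obtain A where A: "finite A" "\<And>w a b. (a, b) \<in> A \<Longrightarrow> a \<bullet> w + b \<le> h w"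
    "\<And>w. \<exists>a b. (a, b) \<in> A \<and> h w = a \<bullet> w + b" by (metis max_affineE[OF assms])
  let ?S = "(\<lambda>(a, b). (a *\<^sub>R x, b)) ` A"
  show ?thesis
  proof (rule max_affineI[of ?S])
    show "finite ?S" using A(1) by simp
  next
    fix w a b assume "(a, b) \<in> ?S"
    then obtain a1 where "(a1, b) \<in> A" "a = a1 *\<^sub>R x"
      by auto
    then show "a \<bullet> w + b \<le> h (w \<bullet> x)"
      using A(2)[of a1 b "w \<bullet> x"] by (simp add: inner_commute)
  next
    fix w
    obtain a1 b1 where 1: "(a1, b1) \<in> A" "h (w \<bullet> x) = a1 \<bullet> (w \<bullet> x) + b1" using A(3) by blast
    have "(a1 *\<^sub>R x, b1) \<in> ?S" using 1(1) by force
    moreover have "h (w \<bullet> x) = (a1 *\<^sub>R x) \<bullet> w + b1" using 1 by (simp add: inner_commute)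
    ultimately show "\<exists>a b. (a, b) \<in> ?S \<and> h (w \<bullet> x) = a \<bullet> w + b" by blast
  qed
qed

lemma max_affine_imp_convex_on:
  assumes "max_affine h"
  shows "convex_on UNIV h"
proof (rule convex_onI)
  obtain A where A: "finite A" "\<And>w a b. (a, b) \<in> A \<Longrightarrow> a \<bullet> w + b \<le> h w"
    "\<And>w. \<exists>a b. (a, b) \<in> A \<and> h w = a \<bullet> w + b" by (metis max_affineE[OF assms])
  fix t :: real and u v :: 'a
  assume t: "0 < t" "t < 1"
  obtain a b where ab: "(a, b) \<in> A" "h ((1 - t) *\<^sub>R u + t *\<^sub>R v) = a \<bullet> ((1 - t) *\<^sub>R u + t *\<^sub>R v) + b"
    using A(3) by blast
  have "a \<bullet> ((1 - t) *\<^sub>R u + t *\<^sub>R v) + b = (1 - t) * (a \<bullet> u + b) + t * (a \<bullet> v + b)"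
    by (simp add: inner_add_right algebra_simps)
  also have "\<dots> \<le> (1 - t) * h u + t * h v"
    using t A(2)[OF ab(1)] by (intro add_mono mult_left_mono) auto
  finally show "h ((1 - t) *\<^sub>R u + t *\<^sub>R v) \<le> (1 - t) * h u + t * h v" using ab(2) by simp
qed simp

lemma max_affine_imp_lipschitz:
  assumes "max_affine h"
  obtains L where "0 \<le> L" "L-lipschitz_on UNIV h"
proof -
  obtain A where A: "finite A" "\<And>w a b. (a, b) \<in> A \<Longrightarrow> a \<bullet> w + b \<le> h w"
    "\<And>w. \<exists>a b. (a, b) \<in> A \<and> h w = a \<bullet> w + b" by (metis max_affineE[OF assms])
  define L where "L = (\<Sum>p\<in>A. norm (fst p))"
  have L: "norm a \<le> L" if "(a, b) \<in> A" for a b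
    using member_le_sum[of "(a, b)" A "\<lambda>p. norm (fst p)"] that A(1) by (auto simp: L_def)
  have le: "h u - h v \<le> L * dist u v" for u v
  proof -
    obtain a b where ab: "(a, b) \<in> A" "h u = a \<bullet> u + b" using A(3) by blast
    have "h u - h v \<le> a \<bullet> (u - v)" using A(2)[OF ab(1), of v] ab(2) by (simp add: inner_diff_right)
    also have "\<dots> \<le> norm a * norm (u - v)" by (rule norm_cauchy_schwarz)
    also have "\<dots> \<le> L * norm (u - v)" using L[OF ab(1)] by (intro mult_right_mono) auto
    finally show ?thesis by (simp add: dist_norm)
  qed
  have "0 \<le> L" by (simp add: L_def sum_nonneg)
  moreover have "L-lipschitz_on UNIV h"
  proof (rule lipschitz_onI[OF _ \<open>0 \<le> L\<close>])
    fix u v show "dist (h u) (h v) \<le> L * dist u v"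
      using le[of u v] le[of v u] by (simp add: dist_real_def dist_commute abs_le_iff)
  qed
  ultimately show ?thesis using that by blast
qed

section \<open>Convex piecewise linear functions\<close>

text \<open>Moving from an interior point \<open>z0\<close> of the piece a little towards \<open>u\<close> stays in the piece, where \<open>h\<close> agrees with the
  affine function. By convexity this value is at most that of the chord from \<open>h z0\<close> to \<open>h u\<close>, and \<open>h z0\<close>
  is a value of the affine function too.\<close>

lemma affine_piece_le_convex:
  assumes "convex_on UNIV h" "z0 \<in> interior P" "\<And>z. z \<in> P \<Longrightarrow> h z = a \<bullet> z + b"
  shows "a \<bullet> u + b \<le> h u"
proof -
  obtain r where r: "r > 0" "ball z0 r \<subseteq> P" using assms(2) by (auto simp: mem_interior)
  define t where "t = r / (r + norm (u - z0) + 1)"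
  have t: "0 < t" "t < 1" using r(1) by (auto simp: t_def add_nonneg_pos)
  have "t * norm (u - z0) < r"
    unfolding t_def using r(1) by (simp add: field_simps add_pos_nonneg add_nonneg_pos)
  then have "z0 + t *\<^sub>R (u - z0) \<in> P" using r t by (intro subsetD[OF r(2)]) (simp add: dist_norm)
  then have "a \<bullet> (z0 + t *\<^sub>R (u - z0)) + b = h (z0 + t *\<^sub>R (u - z0))" using assms(3) by simp
  also have "\<dots> = h ((1 - t) *\<^sub>R z0 + t *\<^sub>R u)" by (simp add: algebra_simps)
  also have "\<dots> \<le> (1 - t) * h z0 + t * h u"
    using t convex_onD[OF assms(1), of t z0 u] by simp
  also have "h z0 = a \<bullet> z0 + b" using assms(2,3) interior_subset by blast
  finally have "t * (a \<bullet> u + b) \<le> t * h u" by (simp add: algebra_simps)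
  then show ?thesis using t by simp
qed

lemma interior_Union_closed_empty_interior:
  assumes "finite \<Q>" "\<And>P. P \<in> \<Q> \<Longrightarrow> closed P \<and> interior P = {}"
  shows "interior (\<Union>\<Q>) = {}"
  using assms
proof (induction \<Q>)
  case (insert P \<Q>)
  then have "interior (P \<union> \<Union>\<Q>) = interior P"
    by (intro interior_closed_Un_empty_interior) auto
  with insert show ?case by simp
qed simp

text \<open>Only the pieces with nonempty interior are known to yield affine minorants. They already cover the whole space:
  the remaining pieces are finitely many closed sets with empty interior, so the complement of their
  union is dense, and the union of the full-dimensional pieces is closed.\<close>

lemma convex_piecewise_linear_imp_max_affine:
  fixes h :: "'a::euclidean_space \<Rightarrow> real"
  assumes "convex_on UNIV h" "piecewise_linear h"
  shows "max_affine h"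
proof -
  obtain \<P> where P: "finite \<P>" "\<Union>\<P> = (UNIV :: 'a set)"
    "\<And>P. P \<in> \<P> \<Longrightarrow> closed P" "\<forall>P\<in>\<P>. \<exists>a b. \<forall>z\<in>P. h z = a \<bullet> z + b"
    using assms(2) polyhedron_imp_closed unfolding piecewise_linear_def by meson
  obtain a b where ab: "\<And>P z. P \<in> \<P> \<Longrightarrow> z \<in> P \<Longrightarrow> h z = a P \<bullet> z + b P"
    using P(4) by metis
  define \<Q> where "\<Q> = {P\<in>\<P>. interior P \<noteq> {}}"
  have fin: "finite \<Q>" "finite (\<P> - \<Q>)" using P(1) by (auto simp: \<Q>_def)
  have "closed (\<Union>\<Q>)" using fin P(3) by (auto simp: \<Q>_def)
  moreover have "interior (\<Union>(\<P> - \<Q>)) = {}"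
    using fin P(3) by (intro interior_Union_closed_empty_interior) (auto simp: \<Q>_def)
  ultimately have "interior (\<Union>\<Q> \<union> \<Union>(\<P> - \<Q>)) = interior (\<Union>\<Q>)"
    by (rule interior_closed_Un_empty_interior)
  moreover have "\<Union>\<Q> \<union> \<Union>(\<P> - \<Q>) = \<Union>\<P>" unfolding \<Q>_def
    by (subst Union_Un_distrib[symmetric]) (rule arg_cong[of _ _ Union], auto)
  ultimately have "interior (\<Union>\<Q>) = UNIV" using P(2) by simp
  then have cover: "\<Union>\<Q> = UNIV" using interior_subset[of "\<Union>\<Q>"] by blast
  show ?thesis
  proof (rule max_affineI[of "(\<lambda>P. (a P, b P)) ` \<Q>"])
    show "finite ((\<lambda>P. (a P, b P)) ` \<Q>)" using fin by simp
  next
    fix w c d assume "(c, d) \<in> (\<lambda>P. (a P, b P)) ` \<Q>"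
    then obtain P where P: "P \<in> \<P>" "interior P \<noteq> {}" "c = a P" "d = b P" by (auto simp: \<Q>_def)
    then obtain z0 where "z0 \<in> interior P" by blast
    with affine_piece_le_convex[OF assms(1) this] ab[OF P(1)] P(3,4)
    show "c \<bullet> w + d \<le> h w" by simp
  next
    fix w
    obtain P where "P \<in> \<Q>" "w \<in> P" using cover by blast
    with ab[of P w] show "\<exists>c d. (c, d) \<in> (\<lambda>P. (a P, b P)) ` \<Q> \<and> h w = c \<bullet> w + d"
      by (auto simp: \<Q>_def)
  qed
qed

section \<open>The three norms\<close>

lemma max_affine_l1_norm: "max_affine (l1_norm :: real ^ 'd \<Rightarrow> real)"
proof -
  have "max_affine (\<lambda>w :: real ^ 'd. \<Sum>j\<in>UNIV. \<bar>w \<bullet> axis j 1\<bar>)"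
    by (intro max_affine_sum max_affine_abs_inner)
  then show ?thesis by (simp add: l1_norm_def[abs_def] inner_axis)
qed

lemma max_affine_infnorm: "max_affine (infnorm :: 'a::euclidean_space \<Rightarrow> real)"
  unfolding infnorm_Max[abs_def]
  by (intro max_affine_Max max_affine_abs_inner finite_Basis nonempty_Basis)

lemma max_affine_l1inf_norm:
  fixes \<B> :: "'d::finite set set"
  assumes "partition_on UNIV \<B>"
  shows "max_affine (l1inf_norm \<B>)"
proof -
  have "max_affine (\<lambda>w :: real ^ 'd. \<Sum>B\<in>\<B>. Max ((\<lambda>j. \<bar>w \<bullet> axis j 1\<bar>) ` B))"
    using partition_onD3[OF assms] by (intro max_affine_sum max_affine_Max max_affine_abs_inner) auto
  then show ?thesis by (simp add: l1inf_norm_def[abs_def] inner_axis)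
qed

section \<open>Growth away from the minimizers\<close>

lemma minimizers_minimal: "p \<in> minimizers F \<Longrightarrow> F p \<le> F w"
  for F :: "'a \<Rightarrow> real"
  by (auto simp: minimizers_def is_arg_min_linorder)

lemma minimizers_value:
  fixes F :: "'a \<Rightarrow> real"
  assumes "p \<in> minimizers F"
  shows "F p = min_value F"
  unfolding min_value_def
  by (rule cInf_eq_minimum[symmetric]) (use minimizers_minimal[OF assms] in auto)

lemma minimizers_eq_sublevel:
  fixes F :: "'a \<Rightarrow> real"
  assumes "minimizers F \<noteq> {}"
  shows "minimizers F = {w. F w \<le> min_value F}" and "min_value F \<le> F w"
proof -
  obtain p where p: "p \<in> minimizers F" using assms by blast
  show "min_value F \<le> F w" using minimizers_minimal[OF p, of w] minimizers_value[OF p] by simp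
  show "minimizers F = {w. F w \<le> min_value F}"
    using minimizers_minimal[OF p] minimizers_value[OF p]
    by (auto simp: minimizers_value) (auto simp: minimizers_def is_arg_min_linorder intro: order_trans)
qed

lemma closed_convex_minimizers:
  fixes F :: "'a::euclidean_space \<Rightarrow> real"
  assumes "minimizers F \<noteq> {}" "convex_on UNIV F"
  shows "closed (minimizers F)" "convex (minimizers F)"
proof -
  have "continuous_on UNIV F" using assms(2) by (intro convex_on_continuous) auto
  then have "closed {w. F w \<le> min_value F}" by (intro closed_Collect_le) auto
  then show "closed (minimizers F)" by (simp only: minimizers_eq_sublevel(1)[OF assms(1)])
  show "convex (minimizers F)" unfolding minimizers_eq_sublevel(1)[OF assms(1)]
  proof (rule convexI)
    fix u v :: 'a and a b :: real
    assume *: "u \<in> {w. F w \<le> min_value F}" "v \<in> {w. F w \<le> min_value F}" "0 \<le> a" "0 \<le> b" "a + b = 1"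
    then have "F (a *\<^sub>R u + b *\<^sub>R v) \<le> a * F u + b * F v"
      using assms(2) by (simp add: convex_on_def)
    also have "\<dots> \<le> a * min_value F + b * min_value F" using * by (intro add_mono mult_left_mono) auto
    also have "\<dots> = min_value F" using *(5) by (metis distrib_right mult_1)
    finally show "a *\<^sub>R u + b *\<^sub>R v \<in> {w. F w \<le> min_value F}" by simp
  qed
qed

text \<open>\<open>A\<close> plays the role of the affine pieces that are active at a minimizer \<open>p\<close>. The directions \<open>v\<close> with
  \<open>a \<bullet> v \<le> 0\<close> for all of them are those in which one can move from \<open>p\<close> without leaving the set of
  minimizers, so the vectors \<open>d\<close> considered are the unit normals at \<open>p\<close>. The slope
  \<open>\<phi> d\<close>, the maximum of the \<open>a \<bullet> d\<close>, is positive for such a \<open>d\<close>: otherwise \<open>v = d\<close> would be one of these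
  directions and \<open>d \<bullet> d \<le> 0\<close>. Compactness of the set of unit normals makes it uniformly positive.\<close>

lemma positive_slope_on_normals:
  fixes A :: "('a::euclidean_space \<times> real) set"
  assumes "finite A"
  obtains m where "0 < m"
    "\<And>d. norm d = 1 \<Longrightarrow> (\<And>v. \<forall>(a, b)\<in>A. a \<bullet> v \<le> 0 \<Longrightarrow> d \<bullet> v \<le> 0) \<Longrightarrow> \<exists>(a, b)\<in>A. m \<le> a \<bullet> d"
proof (cases "A = {}")
  case True
  have False if "norm d = 1" "\<And>v. d \<bullet> v \<le> 0" for d :: 'a
    using that(2)[of d] that(1) by (simp add: dot_square_norm)
  then show ?thesis using True by (intro that[of 1]) auto
next
  case False
  define C where "C = sphere 0 1 \<inter> (\<Inter>v\<in>{v. \<forall>(a, b)\<in>A. a \<bullet> v \<le> 0}. {d :: 'a. d \<bullet> v \<le> 0})"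
  have "compact C" unfolding C_def
    by (intro compact_Int_closed closed_INT ballI closed_Collect_le continuous_intros) auto
  define \<phi> where "\<phi> d = Max ((\<lambda>(a, b). a \<bullet> d) ` A)" for d :: 'a
  have "max_affine \<phi>" unfolding \<phi>_def
  proof -
    have "max_affine (\<lambda>d. Max ((\<lambda>p. fst p \<bullet> d + 0) ` A))"
      using assms False by (intro max_affine_Max max_affine_affine)
    then show "max_affine (\<lambda>d. Max ((\<lambda>(a, b). a \<bullet> d) ` A))" by (simp add: case_prod_beta)
  qed
  then have cont: "continuous_on C \<phi>"
    by (meson max_affine_imp_lipschitz lipschitz_on_continuous_on continuous_on_subset subset_UNIV)
  have pos: "0 < \<phi> d" if "d \<in> C" for d
  proof (rule ccontr)
    assume "\<not> 0 < \<phi> d"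
    then have "\<forall>(a, b)\<in>A. a \<bullet> d \<le> 0"
      using assms False by (auto simp: \<phi>_def not_less)
    then have "d \<bullet> d \<le> 0" using that by (auto simp: C_def)
    moreover have "norm d = 1" using that by (auto simp: C_def)
    ultimately show False by (simp add: dot_square_norm)
  qed
  obtain m where m: "0 < m" "\<And>d. d \<in> C \<Longrightarrow> m \<le> \<phi> d"
  proof (cases "C = {}")
    case True then show ?thesis using that[of 1] by simp
  next
    case False
    from continuous_attains_inf[OF \<open>compact C\<close> this cont] obtain d where "d \<in> C" "\<forall>y\<in>C. \<phi> d \<le> \<phi> y"
      by blast
    then show ?thesis using that[of "\<phi> d"] pos by blast
  qed
  show ?thesis
  proof (rule that[OF m(1)])
    fix d :: 'a assume "norm d = 1" "\<And>v. \<forall>(a, b)\<in>A. a \<bullet> v \<le> 0 \<Longrightarrow> d \<bullet> v \<le> 0"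
    then have "m \<le> \<phi> d" by (intro m) (auto simp: C_def)
    moreover have "\<phi> d \<in> (\<lambda>(a, b). a \<bullet> d) ` A" unfolding \<phi>_def using assms False by (intro Max_in) auto
    ultimately show "\<exists>(a, b)\<in>A. m \<le> a \<bullet> d" by force
  qed
qed

text \<open>Hoffman's error bound. The constant is the reciprocal of the smallest slope that
  \<open>positive_slope_on_normals\<close> provides for the finitely many subsets of the affine pieces.\<close>

lemma max_affine_growth:
  fixes F :: "'a::euclidean_space \<Rightarrow> real"
  assumes "max_affine F" "minimizers F \<noteq> {}"
  obtains c where "0 < c"
    "\<And>w. norm (w - closest_point (minimizers F) w) \<le> c * (F w - min_value F)"
proof -
  obtain A where A: "finite A" "\<And>w a b. (a, b) \<in> A \<Longrightarrow> a \<bullet> w + b \<le> F w"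
    "\<And>w. \<exists>a b. (a, b) \<in> A \<and> F w = a \<bullet> w + b" by (metis max_affineE[OF assms(1)])
  let ?S = "minimizers F" and ?m = "min_value F"
  note S = minimizers_eq_sublevel[OF assms(2)]
  have cl: "closed ?S" "convex ?S"
    using closed_convex_minimizers[OF assms(2) max_affine_imp_convex_on[OF assms(1)]] by auto
  have "\<forall>B\<in>Pow A. \<exists>m>0. \<forall>d. norm d = 1 \<longrightarrow> (\<forall>v. (\<forall>(a, b)\<in>B. a \<bullet> v \<le> 0) \<longrightarrow> d \<bullet> v \<le> 0) \<longrightarrow>
      (\<exists>(a, b)\<in>B. m \<le> a \<bullet> d)"
    using positive_slope_on_normals finite_subset[OF _ A(1)] by (metis PowD)
  then obtain m where m: "\<And>B. B \<subseteq> A \<Longrightarrow> 0 < m B"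
    "\<And>B d. B \<subseteq> A \<Longrightarrow> norm d = 1 \<Longrightarrow> (\<forall>v. (\<forall>(a, b)\<in>B. a \<bullet> v \<le> 0) \<longrightarrow> d \<bullet> v \<le> 0) \<Longrightarrow>
      (\<exists>(a, b)\<in>B. m B \<le> a \<bullet> d)"
    by (metis PowI)
  define \<mu> where "\<mu> = Min (m ` Pow A)"
  have "\<mu> \<in> m ` Pow A" using A(1) unfolding \<mu>_def by (intro Min_in) auto
  then have \<mu>: "0 < \<mu>" "\<And>B. B \<subseteq> A \<Longrightarrow> \<mu> \<le> m B"
    using A(1) m(1) by (auto simp: \<mu>_def)
  have "norm (w - closest_point ?S w) \<le> (1 / \<mu>) * (F w - ?m)" for w
  proof -
    define p where "p = closest_point ?S w"
    have pS: "p \<in> ?S" using closest_point_in_set[OF cl(1) assms(2)] by (simp add: p_def)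
    then have Fp: "F p = ?m" by (rule minimizers_value)
    define B where "B = {(a, b)\<in>A. a \<bullet> p + b = ?m}"
    have BA: "B \<subseteq> A" by (auto simp: B_def)
    show ?thesis
    proof (cases "w = p")
      case True
      then have "w - closest_point ?S w = 0" by (simp add: p_def)
      then show ?thesis using S(2)[of w] \<mu>(1) by simp
    next
      case False
      define d where "d = (1 / norm (w - p)) *\<^sub>R (w - p)"
      have nd: "norm d = 1" using False by (simp add: d_def)
      \<comment> \<open>If \<open>v\<close> increases no active piece, then a short step from \<open>p\<close> along \<open>v\<close> keeps also the inactive
        pieces below the minimum. It therefore stays in the set of minimizers, where \<open>p\<close> is closest to \<open>w\<close>.\<close>
      have normal: "d \<bullet> v \<le> 0" if v: "\<forall>(a, b)\<in>B. a \<bullet> v \<le> 0" for v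
      proof -
        have "\<forall>\<^sub>F t in at_right 0. \<forall>q\<in>A. fst q \<bullet> (p + t *\<^sub>R v) + snd q \<le> ?m"
          unfolding eventually_ball_finite_distrib[OF A(1)]
        proof
          fix q assume q: "q \<in> A"
          show "\<forall>\<^sub>F t in at_right 0. fst q \<bullet> (p + t *\<^sub>R v) + snd q \<le> ?m"
          proof (cases "q \<in> B")
            case True
            then have "fst q \<bullet> p + snd q = ?m" "fst q \<bullet> v \<le> 0" using v by (auto simp: B_def)
            then have "fst q \<bullet> (p + t *\<^sub>R v) + snd q \<le> ?m" if "0 < t" for t
              using mult_nonneg_nonpos[of t "fst q \<bullet> v"] that by (simp add: inner_add_right)
            then show ?thesis by (auto simp: eventually_at_right_less eventually_at_filter)
          next
            case False
            then have "fst q \<bullet> p + snd q < ?m"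
              using q A(2)[of "fst q" "snd q" p] Fp by (force simp: B_def)
            moreover have "((\<lambda>t. fst q \<bullet> (p + t *\<^sub>R v) + snd q) \<longlongrightarrow> fst q \<bullet> (p + 0 *\<^sub>R v) + snd q)
                (at_right 0)"
              by (intro tendsto_intros)
            ultimately have "\<forall>\<^sub>F t in at_right 0. fst q \<bullet> (p + t *\<^sub>R v) + snd q < ?m"
              by (intro order_tendstoD(2)) auto
            then show ?thesis by eventually_elim simp
          qed
        qed
        moreover have "\<forall>\<^sub>F t in at_right (0::real). 0 < t" by (rule eventually_at_right_less)
        ultimately have "\<forall>\<^sub>F t in at_right 0. 0 < t \<and> (\<forall>q\<in>A. fst q \<bullet> (p + t *\<^sub>R v) + snd q \<le> ?m)"
          by eventually_elim simp
        then obtain t where t: "0 < t" "\<forall>q\<in>A. fst q \<bullet> (p + t *\<^sub>R v) + snd q \<le> ?m"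
          using eventually_happens[OF _] trivial_limit_at_right_real by blast
        have "F (p + t *\<^sub>R v) \<le> ?m" using A(3)[of "p + t *\<^sub>R v"] t(2) by force
        then have "p + t *\<^sub>R v \<in> ?S" using S(1) by blast
        from closest_point_dot[OF cl(2,1) this, of w] have "t * ((w - p) \<bullet> v) \<le> 0"
          by (simp add: p_def)
        then have "(w - p) \<bullet> v \<le> 0" using t(1) by (simp add: mult_le_0_iff)
        then show ?thesis by (simp add: d_def divide_nonpos_nonneg)
      qed
      obtain a b where ab: "(a, b) \<in> B" "m B \<le> a \<bullet> d" using m(2)[OF BA nd] normal by blast
      have "a \<bullet> p + b = ?m" "(a, b) \<in> A" using ab(1) by (auto simp: B_def)
      then have "a \<bullet> (w - p) \<le> F w - ?m" using A(2)[of a b w] by (simp add: inner_diff_right)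
      moreover have "\<mu> * norm (w - p) \<le> a \<bullet> d * norm (w - p)"
        using \<mu>(2)[OF BA] ab(2) by (intro mult_right_mono) auto
      moreover have "a \<bullet> d * norm (w - p) = a \<bullet> (w - p)" using False by (simp add: d_def)
      ultimately have "\<mu> * norm (w - p) \<le> F w - ?m" by simp
      then show ?thesis using \<mu>(1) by (simp add: field_simps p_def)
    qed
  qed
  then show ?thesis using that[of "1 / \<mu>"] \<mu>(1) by simp
qed

text \<open>A point \<open>w\<close> outside the sublevel set is pulled along the segment to its closest minimizer \<open>p\<close>, to a
  point \<open>u\<close> with \<open>F u \<le> F\<^sub>* + \<epsilon>\<close>. The closest minimizer to \<open>u\<close> is still \<open>p\<close>, so the local condition
  applies to the distance from \<open>u\<close> to \<open>p\<close>. Along the segment this distance shrinks in proportion,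
  whereas by convexity \<open>F - F\<^sub>*\<close> shrinks at least as much.\<close>

lemma local_growth_imp_global:
  fixes F :: "'a::euclidean_space \<Rightarrow> real"
  assumes "convex_on UNIV F" "minimizers F \<noteq> {}" "0 < \<epsilon>" "local_growth F 1 c \<epsilon>" "0 \<le> c"
  shows "norm (w - closest_point (minimizers F) w) \<le> c * (F w - min_value F)"
proof (cases "F w \<le> min_value F + \<epsilon>")
  case True
  then show ?thesis using assms(4) minimizers_eq_sublevel(2)[OF assms(2), of w]
    by (auto simp: local_growth_def sublevel_def)
next
  case False
  let ?S = "minimizers F"
  define \<Delta> where "\<Delta> = F w - min_value F"
  define t where "t = \<epsilon> / \<Delta>"
  have \<Delta>: "\<epsilon> < \<Delta>" using False by (simp add: \<Delta>_def)
  have t: "0 < t" "t < 1" "t * \<Delta> = \<epsilon>" using \<Delta> assms(3) by (auto simp: t_def)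
  have cl: "closed ?S" "convex ?S" using closed_convex_minimizers[OF assms(2,1)] by auto
  define p where "p = closest_point ?S w"
  have pS: "p \<in> ?S" using closest_point_in_set[OF cl(1) assms(2)] by (simp add: p_def)
  then have Fp: "F p = min_value F" by (rule minimizers_value)
  define u where "u = (1 - t) *\<^sub>R p + t *\<^sub>R w"
  have up: "u - p = t *\<^sub>R (w - p)" and wu: "w - u = (1 - t) *\<^sub>R (w - p)"
    by (auto simp: u_def algebra_simps)
  have "F u \<le> (1 - t) * F p + t * F w" unfolding u_def using t by (intro convex_onD[OF assms(1)]) auto
  also have "\<dots> = min_value F + t * \<Delta>" by (simp add: Fp \<Delta>_def algebra_simps)
  finally have Fu: "F u \<le> min_value F + \<epsilon>" using t(3) by simp
  have "p = closest_point ?S u"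
  proof (rule closest_point_unique[OF cl(2,1) pS], rule ballI)
    fix q assume "q \<in> ?S"
    then have "dist w p \<le> dist w q" unfolding p_def by (rule closest_point_le[OF cl(1)])
    also have "\<dots> \<le> dist w u + dist u q" by (rule dist_triangle)
    finally have "norm (w - p) \<le> norm (w - u) + dist u q" by (simp add: dist_norm)
    moreover have "norm (w - p) = norm (w - u) + norm (u - p)"
      using t unfolding up wu norm_scaleR by (simp add: left_diff_distrib)
    ultimately show "dist u p \<le> dist u q" by (simp add: dist_norm)
  qed
  then have "norm (u - p) \<le> c * (F u - min_value F)"
    using Fu assms(4) minimizers_eq_sublevel(2)[OF assms(2), of u]
    by (force simp: local_growth_def sublevel_def)
  also have "\<dots> \<le> c * \<epsilon>" using Fu assms(5) by (intro mult_left_mono) auto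
  finally have "t * norm (w - p) \<le> t * (c * \<Delta>)" using t by (simp add: up mult.left_commute)
  then show ?thesis using t(1) by (simp add: p_def \<Delta>_def)
qed

section \<open>The empirical risk as a stochastic problem\<close>

text \<open>A subgradient \<open>v\<close> of an \<open>L\<close>-Lipschitz function at \<open>w\<close> satisfies \<open>norm v \<le> L\<close>, as the step from \<open>w\<close> to
  \<open>w + v\<close> shows. The summand 1 in \<open>G\<close> only makes it positive.\<close>

lemma stochastic_problem_uniform:
  fixes h :: "nat \<Rightarrow> 'a::euclidean_space \<Rightarrow> real"
  assumes "1 \<le> n" "\<And>i. i \<in> {1..n} \<Longrightarrow> max_affine (h i)"
  obtains G where "0 < G"
    "\<And>g. (\<forall>w. \<forall>i\<in>{1..n}. g w i \<in> subdifferential (h i) w) \<Longrightarrow>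
      stochastic_problem (uniform_count_measure {1..n}) (\<lambda>w i. h i w) g
        (\<lambda>w. (1 / real n) * (\<Sum>i=1..n. h i w)) G"
proof -
  have "\<forall>i\<in>{1..n}. \<exists>L. 0 \<le> L \<and> L-lipschitz_on UNIV (h i)"
    using assms(2) max_affine_imp_lipschitz by meson
  then obtain L where L: "\<And>i. i \<in> {1..n} \<Longrightarrow> 0 \<le> L i"
    "\<And>i. i \<in> {1..n} \<Longrightarrow> (L i)-lipschitz_on UNIV (h i)"
    by metis
  define G where "G = (\<Sum>i=1..n. L i) + 1"
  have LG: "L i \<le> G" if "i \<in> {1..n}" for i
    using member_le_sum[of i "{1..n}" L] that L(1) by (force simp: G_def)
  have "0 \<le> (\<Sum>i=1..n. L i)" using L(1) by (intro sum_nonneg) auto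
  then have "0 < G" by (simp add: G_def)
  have bound: "norm v \<le> G" if i: "i \<in> {1..n}" and v: "v \<in> subdifferential (h i) w" for i v w
  proof -
    have "v \<bullet> v \<le> h i (w + v) - h i w" using v by (auto simp: subdifferential_def dest: spec[of _ "w + v"])
    also have "\<dots> \<le> L i * norm v"
      using lipschitz_onD[OF L(2)[OF i], of "w + v" w] by (simp add: dist_norm)
    finally have "norm v * norm v \<le> L i * norm v" by (simp add: dot_square_norm power2_eq_square)
    then have "norm v \<le> L i" using L(1)[OF i] by (cases "v = 0") auto
    with LG[OF i] show ?thesis by simp
  qed
  show ?thesis
  proof (rule that[OF \<open>0 < G\<close>])
    fix g :: "'a \<Rightarrow> nat \<Rightarrow> 'a"
    assume g: "\<forall>w. \<forall>i\<in>{1..n}. g w i \<in> subdifferential (h i) w"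
    let ?M = "uniform_count_measure {1..n}"
    have sp: "space ?M = {1..n}" and st: "sets ?M = Pow {1..n}"
      by (simp_all add: space_uniform_count_measure sets_uniform_count_measure)
    have "integrable ?M k" for k :: "nat \<Rightarrow> real"
      unfolding uniform_count_measure_def by (rule integrable_point_measure_finite) simp
    moreover have "(1 / real n) * (\<Sum>i=1..n. h i w) = integral\<^sup>L ?M (\<lambda>i. h i w)" for w
      by (subst integral_uniform_count_measure) auto
    moreover have "prob_space ?M" using assms(1) by (intro prob_space_uniform_count_measure) auto
    ultimately show "stochastic_problem ?M (\<lambda>w i. h i w) g
        (\<lambda>w. (1 / real n) * (\<Sum>i=1..n. h i w)) G"
      unfolding stochastic_problem_def sp st
      using g bound max_affine_imp_convex_on[OF assms(2)] by (auto simp: countable_finite)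
  qed
qed

section \<open>Measurability of the iterates\<close>

text \<open>McShane's formula writes an \<open>L\<close>-Lipschitz function as the infimum of the cones
  \<open>f q s + L * norm (w - q)\<close> over a countable dense set of points \<open>q\<close>. Each cone is jointly
  measurable, and so is a countable infimum of them.\<close>

lemma lipschitz_family_measurable:
  fixes f :: "'a::euclidean_space \<Rightarrow> 'b \<Rightarrow> real"
  assumes meas: "\<And>w. f w \<in> borel_measurable M"
    and lip: "\<And>s u w. s \<in> space M \<Longrightarrow> \<bar>f u s - f w s\<bar> \<le> L * norm (u - w)" and "0 < L"
  shows "(\<lambda>(w, s). f w s) \<in> borel_measurable (borel \<Otimes>\<^sub>M M)"
proof -
  obtain Q :: "'a set" where Q: "countable Q" "\<And>X. open X \<Longrightarrow> X \<noteq> {} \<Longrightarrow> \<exists>q\<in>Q. q \<in> X"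
    using countable_dense_exists by metis
  have "Q \<noteq> {}" using Q(2)[of UNIV] by auto
  note meas[measurable]
  have "(\<lambda>p. INF q\<in>Q. f q (snd p) + L * norm (fst p - q)) \<in> borel_measurable (borel \<Otimes>\<^sub>M M)"
    using Q(1) by measurable
  moreover have "(INF q\<in>Q. f q s + L * norm (w - q)) = f w s" if s: "s \<in> space M" for w s
  proof (rule cInf_eq_non_empty)
    show "(\<lambda>q. f q s + L * norm (w - q)) ` Q \<noteq> {}" using \<open>Q \<noteq> {}\<close> by simp
    show "f w s \<le> y" if "y \<in> (\<lambda>q. f q s + L * norm (w - q)) ` Q" for y
      using that lip[OF s, of w] by (auto simp: abs_le_iff algebra_simps)
    fix y assume y: "\<And>x. x \<in> (\<lambda>q. f q s + L * norm (w - q)) ` Q \<Longrightarrow> y \<le> x"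
    show "y \<le> f w s"
    proof (rule field_le_epsilon)
      fix e :: real assume e: "0 < e"
      have "0 < e / (2 * L)" using e \<open>0 < L\<close> by simp
      then have "ball w (e / (2 * L)) \<noteq> {}" by (simp only: ball_eq_empty not_le)
      then obtain q where q: "q \<in> Q" "q \<in> ball w (e / (2 * L))"
        using Q(2)[OF open_ball] by blast
      have "y \<le> f q s + L * norm (w - q)" using y q(1) by blast
      also have "\<dots> \<le> f w s + 2 * (L * norm (w - q))"
        using lip[OF s, of w q] by (simp add: abs_le_iff)
      also have "2 * (L * norm (w - q)) \<le> e"
        using q(2) \<open>0 < L\<close> by (simp add: dist_norm field_simps)
      finally show "y \<le> f w s + e" by simp
    qed
  qed
  ultimately show ?thesis
    by (subst measurable_cong[where g = "\<lambda>p. INF q\<in>Q. f q (snd p) + L * norm (fst p - q)"])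
      (auto simp: space_pair_measure)
qed

lemma sets_PiM_countable_discrete:
  assumes "finite J" "countable (space M)" "sets M = Pow (space M)"
  shows "sets (PiM J (\<lambda>_. M)) = Pow (space (PiM J (\<lambda>_. M)))"
proof (intro antisym subsetI)
  fix A assume "A \<in> Pow (space (PiM J (\<lambda>_. M)))"
  then have A: "A \<subseteq> space (PiM J (\<lambda>_. M))" by simp
  have "countable (space (PiM J (\<lambda>_. M)))"
    unfolding space_PiM using assms by (intro countable_PiE) auto
  moreover have "{\<omega>} \<in> sets (PiM J (\<lambda>_. M))" if "\<omega> \<in> A" for \<omega>
  proof -
    have \<omega>: "\<omega> \<in> (\<Pi>\<^sub>E i\<in>J. space M)" using A that by (auto simp: space_PiM)
    then have "(\<Pi>\<^sub>E i\<in>J. {\<omega> i}) = {\<omega>}" by (intro PiE_singleton) (auto simp: PiE_def)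
    moreover have "(\<Pi>\<^sub>E i\<in>J. {\<omega> i}) \<in> sets (PiM J (\<lambda>_. M))"
      using \<omega> assms by (intro sets_PiM_I_finite) auto
    ultimately show ?thesis by simp
  qed
  ultimately show "A \<in> sets (PiM J (\<lambda>_. M))"
    by (intro sets.countable[of A]) (simp, rule countable_subset[OF A])
qed (use sets.sets_into_space in auto)

text \<open>The centre of the ball is random in later stages. Translating it to the origin reduces
  measurability in the centre and the projected point to continuity of a single projection.\<close>

lemma closest_point_cball_translate:
  fixes v :: "'a::euclidean_space"
  assumes "0 \<le> D"
  shows "closest_point (cball v D) x = v + closest_point (cball 0 D) (x - v)"
proof (rule closest_point_unique[symmetric])
  have *: "closed (cball (0::'a::euclidean_space) D)" "cball (0::'a) D \<noteq> {}" using assms by auto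
  have "closest_point (cball 0 D) (x - v) \<in> cball 0 D" by (rule closest_point_in_set[OF *])
  then show "v + closest_point (cball 0 D) (x - v) \<in> cball v D" by (simp add: dist_norm)
  show "\<forall>z\<in>cball v D. dist x (v + closest_point (cball 0 D) (x - v)) \<le> dist x z"
  proof
    fix z assume "z \<in> cball v D"
    then have "z - v \<in> cball 0 D" by (simp add: dist_norm norm_minus_commute)
    from closest_point_le[OF *(1) this, of "x - v"]
    show "dist x (v + closest_point (cball 0 D) (x - v)) \<le> dist x z"
      by (simp add: dist_norm algebra_simps)
  qed
qed auto

locale stochastic_subgradients =
  fixes M :: "'b measure" and f :: "'a::euclidean_space \<Rightarrow> 'b \<Rightarrow> real" and g F G
  assumes problem: "stochastic_problem M f g F G" and G_pos: "0 < G"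
begin

sublocale prob_space M using problem by (simp add: stochastic_problem_def)

lemma f_integrable: "integrable M (f w)" and F_eq: "F w = expectation (f w)"
  using problem by (auto simp: stochastic_problem_def)

lemma subgradient_le: "s \<in> space M \<Longrightarrow> f w s - f u s \<le> g w s \<bullet> (w - u)"
  and subgradient_bound: "s \<in> space M \<Longrightarrow> norm (g w s) \<le> G"
proof -
  assume s: "s \<in> space M"
  then have g: "g w s \<in> subdifferential (\<lambda>u. f u s) w"
    using problem by (auto simp: stochastic_problem_def)
  then have "f w s + g w s \<bullet> (u - w) \<le> f u s" by (auto simp: subdifferential_def)
  then show "f w s - f u s \<le> g w s \<bullet> (w - u)" by (simp add: inner_diff_right)
  show "norm (g w s) \<le> G" using problem s g unfolding stochastic_problem_def by blast
qed

lemma f_lipschitz: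
  assumes "s \<in> space M"
  shows "\<bar>f u s - f w s\<bar> \<le> G * norm (u - w)"
proof -
  have "f u s - f w s \<le> G * norm (u - w)" for u w
  proof -
    have "f u s - f w s \<le> g u s \<bullet> (u - w)" by (rule subgradient_le[OF assms])
    also have "\<dots> \<le> norm (g u s) * norm (u - w)" by (rule norm_cauchy_schwarz)
    also have "\<dots> \<le> G * norm (u - w)"
      using subgradient_bound[OF assms] by (intro mult_right_mono) auto
    finally show ?thesis .
  qed
  from this[of u w] this[of w u] show ?thesis by (simp add: abs_le_iff norm_minus_commute)
qed

text \<open>The values of \<open>F\<close> are expectations, so Lipschitz continuity and convexity are inherited from \<open>f\<close>.\<close>

lemma F_lipschitz: "\<bar>F u - F w\<bar> \<le> G * norm (u - w)"
proof -
  have "\<bar>F u - F w\<bar> = \<bar>expectation (\<lambda>s. f u s - f w s)\<bar>"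
    by (simp add: F_eq f_integrable)
  also have "\<dots> \<le> expectation (\<lambda>s. \<bar>f u s - f w s\<bar>)" by (rule integral_abs_bound)
  also have "\<dots> \<le> expectation (\<lambda>_. G * norm (u - w))"
    using f_integrable f_lipschitz by (intro integral_mono) auto
  finally show ?thesis by (simp add: prob_space)
qed

lemma F_convex: "convex_on UNIV F"
proof (rule convex_onI)
  fix t :: real and u v :: 'a
  assume t: "0 < t" "t < 1"
  have "F ((1 - t) *\<^sub>R u + t *\<^sub>R v) \<le> expectation (\<lambda>s. (1 - t) * f u s + t * f v s)"
    unfolding F_eq
  proof (rule integral_mono)
    show "f ((1 - t) *\<^sub>R u + t *\<^sub>R v) s \<le> (1 - t) * f u s + t * f v s" if "s \<in> space M" for s
      using that problem t convex_onD[of UNIV "\<lambda>w. f w s" t u v] by (auto simp: stochastic_problem_def)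
  qed (auto simp: f_integrable)
  then show "F ((1 - t) *\<^sub>R u + t *\<^sub>R v) \<le> (1 - t) * F u + t * F v"
    by (simp add: F_eq f_integrable)
qed simp

lemma F_measurable [measurable]: "F \<in> borel_measurable borel"
  by (intro borel_measurable_continuous_onI convex_on_continuous F_convex) auto

lemma f_measurable [measurable]: "(\<lambda>(w, s). f w s) \<in> borel_measurable (borel \<Otimes>\<^sub>M M)"
  using f_integrable f_lipschitz G_pos by (intro lipschitz_family_measurable[of f M G]) auto

text \<open>The only place where the two alternatives for the subgradient selection \<open>g\<close> matter: if \<open>g\<close> is jointly
  measurable, this is a composition; if the samples are countable and discrete, every function on a
  finite product of the sample space is measurable.\<close>

lemma g_sample_measurable:
  assumes J: "finite J" "i \<in> J" and W: "W \<in> borel_measurable (PiM J (\<lambda>_. M))"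
  shows "(\<lambda>\<omega>. g (W \<omega>) (\<omega> i)) \<in> borel_measurable (PiM J (\<lambda>_. M))"
proof -
  consider "(\<lambda>(w, s). g w s) \<in> borel_measurable (borel \<Otimes>\<^sub>M M)"
    | "countable (space M)" "sets M = Pow (space M)"
    using problem by (auto simp: stochastic_problem_def)
  then show ?thesis
  proof cases
    case 1
    have "(\<lambda>\<omega>. (W \<omega>, \<omega> i)) \<in> PiM J (\<lambda>_. M) \<rightarrow>\<^sub>M borel \<Otimes>\<^sub>M M"
      using J W by (intro measurable_Pair measurable_component_singleton) auto
    from measurable_compose[OF this 1] show ?thesis by simp
  next
    case 2
    then show ?thesis
      using sets_PiM_countable_discrete[OF J(1) 2] by (auto simp: measurable_def)
  qed
qed

lemma ssg_iterate_measurable: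
  assumes "finite J" "v \<in> borel_measurable (PiM J (\<lambda>_. M))" "0 \<le> D"
    and "{r} \<times> {1..j} \<subseteq> J"
  shows "(\<lambda>\<omega>. ssg_iterate g \<eta> D (v \<omega>) (\<lambda>\<tau>. \<omega> (r, \<tau>)) j) \<in> borel_measurable (PiM J (\<lambda>_. M))"
  using assms(4)
proof (induction j)
  case 0
  then show ?case using assms(2) by simp
next
  case (Suc j)
  let ?B = "borel_measurable (PiM J (\<lambda>_. M))"
  let ?w = "\<lambda>\<omega>. ssg_iterate g \<eta> D (v \<omega>) (\<lambda>\<tau>. \<omega> (r, \<tau>)) j"
  have proj: "closest_point (cball (0::'a) D) \<in> borel_measurable borel"
    using assms(3) by (intro borel_measurable_continuous_onI continuous_on_closest_point) auto
  have w: "?w \<in> ?B" using Suc.prems by (intro Suc.IH) auto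
  moreover have "(\<lambda>\<omega>. g (?w \<omega>) (\<omega> (r, Suc j))) \<in> ?B"
    using Suc.prems w by (intro g_sample_measurable assms(1)) auto
  ultimately have step: "(\<lambda>\<omega>. ?w \<omega> - \<eta> *\<^sub>R g (?w \<omega>) (\<omega> (r, Suc j)) - v \<omega>) \<in> ?B" (is "?x \<in> ?B")
    using assms(2) by (intro borel_measurable_diff borel_measurable_scaleR borel_measurable_const)
  have "(\<lambda>\<omega>. v \<omega> + closest_point (cball 0 D) (?x \<omega>)) \<in> ?B"
    by (rule borel_measurable_add[OF assms(2)], rule measurable_compose[OF step proj])
  then show ?case
    by (simp only: ssg_iterate.simps closest_point_cball_translate[OF assms(3), of "v _"])
qed

section \<open>Regret of the projected steps\<close>

text \<open>The textbook telescoping argument: the projection does not increase the distance to the point \<open>u\<close> of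
  the ball, and expanding the square of \<open>w m - \<eta> d - u\<close> produces the inner product that bounds
  \<open>f (w m) - f u\<close> at the current sample.\<close>

lemma ssg_iterate_regret:
  fixes \<zeta> :: "nat \<Rightarrow> 'b"
  assumes "0 < \<eta>" "0 \<le> D" "norm (v - u) \<le> D" "\<And>\<tau>. \<tau> \<in> {1..m} \<Longrightarrow> \<zeta> \<tau> \<in> space M"
  defines "w \<equiv> ssg_iterate g \<eta> D v \<zeta>"
  shows "(\<Sum>j<m. f (w j) (\<zeta> (Suc j)) - f u (\<zeta> (Suc j)))
    \<le> real m * (\<eta> * G\<^sup>2 / 2) + ((norm (v - u))\<^sup>2 - (norm (w m - u))\<^sup>2) / (2 * \<eta>)"
  using assms(4)
proof (induction m)
  case 0
  then show ?case by (simp add: w_def)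
next
  case (Suc m)
  define d where "d = g (w m) (\<zeta> (Suc m))"
  have s: "\<zeta> (Suc m) \<in> space M" using Suc.prems by simp
  have u: "u \<in> cball v D" using assms(3) by (simp add: dist_norm)
  then have ball: "closed (cball v D)" "convex (cball v D)" "cball v D \<noteq> {}"
    using assms(2) by auto
  have "norm (w (Suc m) - u) \<le> norm (w m - \<eta> *\<^sub>R d - u)"
  proof -
    have "dist (closest_point (cball v D) (w m - \<eta> *\<^sub>R d)) (closest_point (cball v D) u)
        \<le> dist (w m - \<eta> *\<^sub>R d) u"
      by (rule closest_point_lipschitz[OF ball(2,1,3)])
    then show ?thesis using closest_point_self[OF u] by (simp add: w_def d_def dist_norm)
  qed
  then have "(norm (w (Suc m) - u))\<^sup>2 \<le> (norm (w m - \<eta> *\<^sub>R d - u))\<^sup>2" by (intro power_mono) auto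
  also have "\<dots> = (norm (w m - u))\<^sup>2 - 2 * \<eta> * (d \<bullet> (w m - u)) + \<eta>\<^sup>2 * (norm d)\<^sup>2"
    unfolding power2_norm_eq_inner power2_eq_square[of \<eta>]
    by (simp add: inner_diff_left inner_diff_right inner_commute algebra_simps)
  also have "\<dots> \<le> (norm (w m - u))\<^sup>2 - 2 * \<eta> * (f (w m) (\<zeta> (Suc m)) - f u (\<zeta> (Suc m))) + \<eta>\<^sup>2 * G\<^sup>2"
    using subgradient_le[OF s, of "w m" u] subgradient_bound[OF s, of "w m"] assms(1)
    by (intro add_mono diff_mono mult_left_mono power_mono) (auto simp: d_def)
  finally have "2 * \<eta> * (f (w m) (\<zeta> (Suc m)) - f u (\<zeta> (Suc m)))
    \<le> \<eta>\<^sup>2 * G\<^sup>2 + ((norm (w m - u))\<^sup>2 - (norm (w (Suc m) - u))\<^sup>2)"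
    by linarith
  then have "f (w m) (\<zeta> (Suc m)) - f u (\<zeta> (Suc m))
    \<le> (\<eta>\<^sup>2 * G\<^sup>2 + ((norm (w m - u))\<^sup>2 - (norm (w (Suc m) - u))\<^sup>2)) / (2 * \<eta>)"
    using assms(1) by (simp add: pos_le_divide_eq mult.commute)
  also have "\<dots> = \<eta> * G\<^sup>2 / 2 + ((norm (w m - u))\<^sup>2 - (norm (w (Suc m) - u))\<^sup>2) / (2 * \<eta>)"
    using assms(1) by (simp add: add_divide_distrib power2_eq_square)
  finally have "f (w m) (\<zeta> (Suc m)) - f u (\<zeta> (Suc m))
    \<le> \<eta> * G\<^sup>2 / 2 + ((norm (w m - u))\<^sup>2 - (norm (w (Suc m) - u))\<^sup>2) / (2 * \<eta>)" .
  moreover have "(\<Sum>j<m. f (w j) (\<zeta> (Suc j)) - f u (\<zeta> (Suc j)))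
    \<le> real m * (\<eta> * G\<^sup>2 / 2) + ((norm (v - u))\<^sup>2 - (norm (w m - u))\<^sup>2) / (2 * \<eta>)"
    using Suc by simp
  ultimately show ?case by (simp add: diff_divide_distrib add_divide_distrib distrib_right)
qed

text \<open>The error made when the gap \<open>F w - F u\<close> is replaced by its observed value at the sample \<open>s\<close>. It has
  expectation 0 for fixed \<open>u\<close> and \<open>w\<close>.\<close>

definition noise :: "'a \<Rightarrow> 'a \<Rightarrow> 'b \<Rightarrow> real" where
  "noise u w s = (F w - F u) - (f w s - f u s)"

definition ssg_noise :: "real \<Rightarrow> real \<Rightarrow> 'a \<Rightarrow> 'a \<Rightarrow> (nat \<Rightarrow> 'b) \<Rightarrow> nat \<Rightarrow> real" where
  "ssg_noise \<eta> D u v \<zeta> m = (\<Sum>j<m. noise u (ssg_iterate g \<eta> D v \<zeta> j) (\<zeta> (Suc j)))"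

text \<open>The average involves \<open>t\<close> iterates but only \<open>t - 1\<close> samples, so the last iterate \<open>w (t - 1)\<close> is
  not covered by \<open>ssg_iterate_regret\<close>. Its gap is at most \<open>G r\<close> with \<open>r\<close> its distance to \<open>u\<close>, and
  \<open>G r \<le> \<eta> G\<^sup>2 / 2 + r\<^sup>2 / (2 \<eta>)\<close>, where the last term cancels against the one left over from the
  telescoping sum. The result is the bound that \<open>t\<close> sampled steps would give.\<close>

lemma ssg_average_regret:
  fixes \<zeta> :: "nat \<Rightarrow> 'b"
  assumes "0 < \<eta>" "0 \<le> D" "norm (v - u) \<le> D" "\<And>\<tau>. \<tau> \<in> {1..<t} \<Longrightarrow> \<zeta> \<tau> \<in> space M" "1 \<le> t"
  shows "F (ssg_average g t \<eta> D v \<zeta>) - F u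
    \<le> \<eta> * G\<^sup>2 / 2 + D\<^sup>2 / (2 * \<eta> * real t)
      + ssg_noise \<eta> D u v \<zeta> (t - 1) / real t"
proof -
  define w where "w = ssg_iterate g \<eta> D v \<zeta>"
  let ?n = "t - 1" and ?r = "norm (w (t - 1) - u)" and ?X = "ssg_noise \<eta> D u v \<zeta> (t - 1)"
  have t: "t = Suc ?n" using assms(5) by simp
  have "F (ssg_average g t \<eta> D v \<zeta>) = F (\<Sum>j<t. (1 / real t) *\<^sub>R w j)"
    by (simp add: ssg_average_def w_def scaleR_sum_right)
  also have "\<dots> \<le> (\<Sum>j<t. (1 / real t) * F (w j))"
    using assms(5) by (intro convex_on_sum[OF _ _ F_convex]) (auto simp: lessThan_empty_iff)
  also have "\<dots> - F u = (\<Sum>j<t. F (w j) - F u) / real t"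
    using assms(5) by (simp add: sum_subtractf sum_divide_distrib[symmetric] diff_divide_distrib)
  finally have avg: "F (ssg_average g t \<eta> D v \<zeta>) - F u \<le> (\<Sum>j<t. F (w j) - F u) / real t" by simp
  \<comment> \<open>the arithmetic-geometric mean inequality for \<open>\<eta> G\<close> and \<open>r\<close>\<close>
  have last: "F (w ?n) - F u \<le> \<eta> * G\<^sup>2 / 2 + ?r\<^sup>2 / (2 * \<eta>)"
  proof -
    have "0 \<le> (\<eta> * G - ?r)\<^sup>2 / (2 * \<eta>)" using assms(1) by simp
    also have "\<dots> = \<eta> * G\<^sup>2 / 2 + ?r\<^sup>2 / (2 * \<eta>) - G * ?r"
      using assms(1) by (simp add: field_simps power2_eq_square)
    finally show ?thesis using F_lipschitz[of "w ?n" u] by simp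
  qed
  have "(\<Sum>j<?n. f (w j) (\<zeta> (Suc j)) - f u (\<zeta> (Suc j)))
    \<le> real ?n * (\<eta> * G\<^sup>2 / 2) + ((norm (v - u))\<^sup>2 - ?r\<^sup>2) / (2 * \<eta>)"
    unfolding w_def using assms by (intro ssg_iterate_regret) auto
  moreover have "(\<Sum>j<t. F (w j) - F u)
    = ?X + (\<Sum>j<?n. f (w j) (\<zeta> (Suc j)) - f u (\<zeta> (Suc j))) + (F (w ?n) - F u)"
    by (subst t) (simp add: ssg_noise_def noise_def sum_subtractf distrib_right flip: w_def)
  ultimately have "(\<Sum>j<t. F (w j) - F u)
    \<le> ?X + real ?n * (\<eta> * G\<^sup>2 / 2) + ((norm (v - u))\<^sup>2 - ?r\<^sup>2) / (2 * \<eta>)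
      + (\<eta> * G\<^sup>2 / 2 + ?r\<^sup>2 / (2 * \<eta>))"
    using last by linarith
  also have "\<dots> = ?X + real t * (\<eta> * G\<^sup>2 / 2) + (norm (v - u))\<^sup>2 / (2 * \<eta>)"
  proof -
    have "real t = real ?n + 1" using assms(5) by simp
    then show ?thesis by (simp only: distrib_right diff_divide_distrib)
  qed
  also have "\<dots> \<le> ?X + real t * (\<eta> * G\<^sup>2 / 2) + D\<^sup>2 / (2 * \<eta>)"
    using assms(1,2,3) by (intro add_left_mono divide_right_mono power_mono) auto
  finally have "(\<Sum>j<t. F (w j) - F u) / real t
    \<le> (?X + real t * (\<eta> * G\<^sup>2 / 2) + D\<^sup>2 / (2 * \<eta>)) / real t"
    by (rule divide_right_mono) simp
  also have "\<dots> = \<eta> * G\<^sup>2 / 2 + D\<^sup>2 / (2 * \<eta> * real t) + ?X / real t"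
    using assms(5) by (simp add: add_divide_distrib)
  finally show ?thesis using avg by linarith
qed

section \<open>Concentration of the noise\<close>

text \<open>Hoeffding's lemma: the noise of one sample is centred and confined to an interval of length \<open>2 G r\<close>.\<close>

lemma noise_mgf:
  assumes "norm (w - u) \<le> r" "0 < l" 
  shows "(\<integral>\<^sup>+ s. ennreal (exp (l * noise u w s)) \<partial>M)
    \<le> ennreal (exp (l\<^sup>2 * G\<^sup>2 * r\<^sup>2 / 2))"
proof -
  let ?X = "\<lambda>s. (F w - F u) - (f w s - f u s)"
  have meas [measurable]: "f w \<in> borel_measurable M" for w using f_integrable by blast
  have *: "\<bar>f w s - f u s\<bar> \<le> G * r" if "s \<in> space M" for s
  proof -
    have "G * norm (w - u) \<le> G * r" using assms(1) G_pos by (intro mult_left_mono) auto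
    with f_lipschitz[OF that, of w u] show ?thesis by linarith
  qed
  interpret X: interval_bounded_random_variable M ?X "(F w - F u) - G * r" "(F w - F u) + G * r"
  proof
    show "?X \<in> borel_measurable M" by measurable
    show "AE s in M. ?X s \<in> {(F w - F u) - G * r..(F w - F u) + G * r}"
    proof (rule AE_I2)
      fix s assume "s \<in> space M"
      from *[OF this] show "?X s \<in> {(F w - F u) - G * r..(F w - F u) + G * r}"
        by (simp add: abs_le_iff; linarith)
    qed
  qed
  have "expectation ?X = 0" by (simp add: F_eq f_integrable prob_space)
  note X.Hoeffdings_lemma_nn_integral_0[OF assms(2) this]
  also have "l\<^sup>2 * ((F w - F u) + G * r - ((F w - F u) - G * r))\<^sup>2 / 8 = l\<^sup>2 * G\<^sup>2 * r\<^sup>2 / 2"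
    by (simp add: power_mult_distrib)
  finally show ?thesis by (simp only: noise_def)
qed

end

text \<open>The next two lemmas record which samples an iterate depends on; they replace a filtration.\<close>

lemma ssg_iterate_cong:
  "(\<And>\<tau>. \<tau> \<in> {1..j} \<Longrightarrow> \<zeta> \<tau> = \<zeta>' \<tau>) \<Longrightarrow> ssg_iterate g \<eta> D v \<zeta> j = ssg_iterate g \<eta> D v \<zeta>' j"
  by (induction j) auto

lemma assg_stage_cong:
  assumes "\<And>k' \<tau>. k' \<in> {1..k} \<Longrightarrow> \<tau> \<in> {1..<t} \<Longrightarrow> \<xi> k' \<tau> = \<xi>' k' \<tau>"
  shows "assg_stage g t \<eta> D v \<xi> k = assg_stage g t \<eta> D v \<xi>' k"
  using assms
proof (induction k)
  case (Suc k)
  then have "assg_stage g t \<eta> D v \<xi> k = assg_stage g t \<eta> D v \<xi>' k" by simp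
  moreover have "ssg_iterate g \<eta>' D' v' (\<xi> (Suc k)) j = ssg_iterate g \<eta>' D' v' (\<xi>' (Suc k)) j"
    if "j < t" for \<eta>' D' v' j
    using that Suc.prems by (intro ssg_iterate_cong) auto
  ultimately show ?case by (simp add: ssg_average_def)
qed simp

context stochastic_subgradients
begin

lemma noise_measurable:
  assumes "u \<in> borel_measurable N" "w \<in> borel_measurable N" "s \<in> N \<rightarrow>\<^sub>M M"
  shows "(\<lambda>x. noise (u x) (w x) (s x)) \<in> borel_measurable N"
proof -
  have "(\<lambda>x. f (w x) (s x)) \<in> borel_measurable N" if "w \<in> borel_measurable N" for w
    using measurable_compose[OF measurable_Pair[OF that assms(3)] f_measurable] by simp
  moreover have "(\<lambda>x. F (w x)) \<in> borel_measurable N" if "w \<in> borel_measurable N" for w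
    using measurable_compose[OF that F_measurable] .
  ultimately show ?thesis unfolding noise_def using assms by (intro borel_measurable_diff)
qed

lemma ssg_noise_measurable:
  assumes "finite J" "{r} \<times> {1..m} \<subseteq> J" "0 \<le> D"
    and "u \<in> borel_measurable (PiM J (\<lambda>_. M))" "v \<in> borel_measurable (PiM J (\<lambda>_. M))"
  shows "(\<lambda>\<omega>. ssg_noise \<eta> D (u \<omega>) (v \<omega>) (\<lambda>\<tau>. \<omega> (r, \<tau>)) m) \<in> borel_measurable (PiM J (\<lambda>_. M))"
  unfolding ssg_noise_def
proof (rule borel_measurable_sum)
  fix j assume "j \<in> {..<m}"
  then have "(r, Suc j) \<in> J" "{r} \<times> {1..j} \<subseteq> J" using assms(2) by auto
  then show "(\<lambda>\<omega>. noise (u \<omega>) (ssg_iterate g \<eta> D (v \<omega>) (\<lambda>\<tau>. \<omega> (r, \<tau>)) j) (\<omega> (r, Suc j)))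
      \<in> borel_measurable (PiM J (\<lambda>_. M))"
    using assms
    by (intro noise_measurable ssg_iterate_measurable measurable_component_singleton)
qed

lemma ssg_iterate_in_ball:
  assumes "0 \<le> D"
  shows "ssg_iterate g \<eta> D v \<zeta> j \<in> cball v D"
proof (cases j)
  case (Suc i)
  then show ?thesis using assms closest_point_in_set[of "cball v D"] by simp
qed (use assms in simp)

text \<open>The samples used by row \<open>r\<close> are the coordinates \<open>(r, 1), \<dots>, (r, m)\<close>, while the starting point \<open>v\<close> and
  the comparison point \<open>u\<close> depend on earlier coordinates \<open>J\<close> only. Integrating out the coordinate
  \<open>(r, m + 1)\<close> first (Fubini), the point \<open>w m\<close> and the earlier noise are constants, and \<open>noise_mgf\<close> with
  distance \<open>2 D\<close> contributes one factor \<open>exp (2 l\<^sup>2 G\<^sup>2 D\<^sup>2)\<close>.\<close>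

lemma ssg_noise_mgf:
  assumes "finite J" "\<And>\<tau>. (r, \<tau>) \<notin> J" "0 \<le> D" "0 < l"
    and u: "\<And>I. finite I \<Longrightarrow> J \<subseteq> I \<Longrightarrow> u \<in> borel_measurable (PiM I (\<lambda>_. M))"
    and v: "\<And>I. finite I \<Longrightarrow> J \<subseteq> I \<Longrightarrow> v \<in> borel_measurable (PiM I (\<lambda>_. M))"
    and uv: "\<And>\<omega>. norm (v \<omega> - u \<omega>) \<le> D"
    and indep: "\<And>\<omega> i s. fst i = r \<Longrightarrow> u (fun_upd \<omega> i s) = u \<omega>"
      "\<And>\<omega> i s. fst i = r \<Longrightarrow> v (fun_upd \<omega> i s) = v \<omega>"
  shows "(\<integral>\<^sup>+ \<omega>. ennreal (exp (l * ssg_noise \<eta> D (u \<omega>) (v \<omega>) (\<lambda>\<tau>. \<omega> (r, \<tau>)) m))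
        \<partial>PiM (J \<union> {r} \<times> {1..m}) (\<lambda>_. M))
    \<le> ennreal (exp (real m * (2 * l\<^sup>2 * G\<^sup>2 * D\<^sup>2)))"
proof (induction m)
  interpret P: product_prob_space "\<lambda>_ :: 'c \<times> nat. M" ..
  case 0
  interpret J: prob_space "PiM J (\<lambda>_. M)" by (intro prob_space_PiM prob_space_axioms)
  show ?case by (simp add: ssg_noise_def J.emeasure_space_1)
next
  interpret P: product_prob_space "\<lambda>_ :: 'c \<times> nat. M" ..
  case (Suc m)
  let ?I = "J \<union> {r} \<times> {1..m}" and ?i = "(r, Suc m)"
  let ?Y = "\<lambda>m \<omega>. ssg_noise \<eta> D (u \<omega>) (v \<omega>) (\<lambda>\<tau>. \<omega> (r, \<tau>)) m"
  let ?w = "\<lambda>\<omega>. ssg_iterate g \<eta> D (v \<omega>) (\<lambda>\<tau>. \<omega> (r, \<tau>)) m"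
  let ?c = "ennreal (exp (2 * l\<^sup>2 * G\<^sup>2 * D\<^sup>2))"
  have I: "finite ?I" "?i \<notin> ?I" using assms(1,2) by auto
  have ins: "J \<union> {r} \<times> {1..Suc m} = insert ?i ?I" by auto
  have meas: "?Y k \<in> borel_measurable (PiM K (\<lambda>_. M))" if "finite K" "J \<union> {r} \<times> {1..k} \<subseteq> K" for K k
    using that assms(3) u v by (intro ssg_noise_measurable) auto
  have step: "?Y (Suc m) (fun_upd \<omega> ?i s) = ?Y m \<omega> + noise (u \<omega>) (?w \<omega>) s" for \<omega> s
  proof -
    have "ssg_iterate g \<eta> D (v \<omega>) (\<lambda>\<tau>. (fun_upd \<omega> ?i s) (r, \<tau>)) j
        = ssg_iterate g \<eta> D (v \<omega>) (\<lambda>\<tau>. \<omega> (r, \<tau>)) j" if "j \<le> m" for j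
      using that by (intro ssg_iterate_cong) auto
    then show ?thesis by (simp add: ssg_noise_def indep)
  qed
  have dist: "norm (?w \<omega> - u \<omega>) \<le> 2 * D" for \<omega>
    using ssg_iterate_in_ball[OF assms(3), of \<eta> "v \<omega>" "\<lambda>\<tau>. \<omega> (r, \<tau>)" m] uv[of \<omega>]
      norm_triangle_ineq[of "?w \<omega> - v \<omega>" "v \<omega> - u \<omega>"]
    by (simp add: dist_norm norm_minus_commute)
  have inner: "(\<integral>\<^sup>+ s. ennreal (exp (l * ?Y (Suc m) (fun_upd \<omega> ?i s))) \<partial>M)
      \<le> ennreal (exp (l * ?Y m \<omega>)) * ?c" for \<omega>
  proof -
    have "(\<integral>\<^sup>+ s. ennreal (exp (l * ?Y (Suc m) (fun_upd \<omega> ?i s))) \<partial>M)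
        = (\<integral>\<^sup>+ s. ennreal (exp (l * ?Y m \<omega>)) * ennreal (exp (l * noise (u \<omega>) (?w \<omega>) s)) \<partial>M)"
      by (simp only: step distrib_left exp_add ennreal_mult' exp_ge_zero)
    also have "\<dots> = ennreal (exp (l * ?Y m \<omega>)) * (\<integral>\<^sup>+ s. ennreal (exp (l * noise (u \<omega>) (?w \<omega>) s)) \<partial>M)"
    proof (rule nn_integral_cmult)
      have "noise (u \<omega>) (?w \<omega>) \<in> borel_measurable M"
        using noise_measurable[of "\<lambda>_. u \<omega>" M "\<lambda>_. ?w \<omega>" "\<lambda>s. s"] by simp
      then show "(\<lambda>s. ennreal (exp (l * noise (u \<omega>) (?w \<omega>) s))) \<in> borel_measurable M" by measurable
    qed
    also have "\<dots> \<le> ennreal (exp (l * ?Y m \<omega>)) * ?c"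
      using noise_mgf[OF dist[of \<omega>] assms(4)]
      by (intro mult_left_mono) (simp_all add: power_mult_distrib algebra_simps)
    finally show ?thesis .
  qed
  have "(\<integral>\<^sup>+ \<omega>. ennreal (exp (l * ?Y (Suc m) \<omega>)) \<partial>PiM (J \<union> {r} \<times> {1..Suc m}) (\<lambda>_. M))
      = (\<integral>\<^sup>+ \<omega>. \<integral>\<^sup>+ s. ennreal (exp (l * ?Y (Suc m) (fun_upd \<omega> ?i s))) \<partial>M \<partial>PiM ?I (\<lambda>_. M))"
  proof -
    have "?Y (Suc m) \<in> borel_measurable (PiM (insert ?i ?I) (\<lambda>_. M))"
      using I(1) by (intro meas) auto
    then have "(\<lambda>\<omega>. ennreal (exp (l * ?Y (Suc m) \<omega>))) \<in> borel_measurable (PiM (insert ?i ?I) (\<lambda>_. M))"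
      by measurable
    from P.product_nn_integral_insert[OF I this] show ?thesis unfolding ins .
  qed
  also have "\<dots> \<le> (\<integral>\<^sup>+ \<omega>. ennreal (exp (l * ?Y m \<omega>)) * ?c \<partial>PiM ?I (\<lambda>_. M))"
    by (intro nn_integral_mono inner)
  also have "\<dots> = (\<integral>\<^sup>+ \<omega>. ennreal (exp (l * ?Y m \<omega>)) \<partial>PiM ?I (\<lambda>_. M)) * ?c"
  proof (rule nn_integral_multc)
    have "?Y m \<in> borel_measurable (PiM ?I (\<lambda>_. M))" using I(1) by (intro meas) auto
    then show "(\<lambda>\<omega>. ennreal (exp (l * ?Y m \<omega>))) \<in> borel_measurable (PiM ?I (\<lambda>_. M))" by measurable
  qed
  also have "\<dots> \<le> ennreal (exp (real m * (2 * l\<^sup>2 * G\<^sup>2 * D\<^sup>2))) * ?c"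
    by (intro mult_right_mono Suc.IH) simp
  also have "\<dots> = ennreal (exp (real (Suc m) * (2 * l\<^sup>2 * G\<^sup>2 * D\<^sup>2)))"
    by (simp add: ennreal_mult'[symmetric] exp_add[symmetric] algebra_simps)
  finally show ?case .
qed

text \<open>Markov's inequality for the exponential moment. The choice \<open>l = x / (4 t G\<^sup>2 D\<^sup>2)\<close> minimizes the exponent
  \<open>- l x + 2 t l\<^sup>2 G\<^sup>2 D\<^sup>2\<close>.\<close>

lemma ssg_noise_tail:
  assumes "finite J" "\<And>\<tau>. (r, \<tau>) \<notin> J" "0 < D" "0 < x" "m \<le> t" "1 \<le> t"
    and u: "\<And>I. finite I \<Longrightarrow> J \<subseteq> I \<Longrightarrow> u \<in> borel_measurable (PiM I (\<lambda>_. M))"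
    and v: "\<And>I. finite I \<Longrightarrow> J \<subseteq> I \<Longrightarrow> v \<in> borel_measurable (PiM I (\<lambda>_. M))"
    and uv: "\<And>\<omega>. norm (v \<omega> - u \<omega>) \<le> D"
    and indep: "\<And>\<omega> i s. fst i = r \<Longrightarrow> u (fun_upd \<omega> i s) = u \<omega>"
      "\<And>\<omega> i s. fst i = r \<Longrightarrow> v (fun_upd \<omega> i s) = v \<omega>"
  defines "N \<equiv> PiM (J \<union> {r} \<times> {1..m}) (\<lambda>_. M)"
  shows "measure N {\<omega>\<in>space N. x \<le> ssg_noise \<eta> D (u \<omega>) (v \<omega>) (\<lambda>\<tau>. \<omega> (r, \<tau>)) m}
    \<le> exp (- (x\<^sup>2 / (8 * real t * G\<^sup>2 * D\<^sup>2)))"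
proof -
  let ?Y = "\<lambda>\<omega>. ssg_noise \<eta> D (u \<omega>) (v \<omega>) (\<lambda>\<tau>. \<omega> (r, \<tau>)) m"
  define l where "l = x / (4 * real t * G\<^sup>2 * D\<^sup>2)"
  have l: "0 < l" using assms G_pos by (simp add: l_def)
  interpret N: prob_space N unfolding N_def by (intro prob_space_PiM prob_space_axioms)
  have Y [measurable]: "?Y \<in> borel_measurable N"
    unfolding N_def using assms by (intro ssg_noise_measurable) auto
  have "emeasure N {\<omega>\<in>space N. x \<le> ?Y \<omega>}
      = emeasure N {\<omega>\<in>space N. 1 \<le> ennreal (exp (- l * x)) * ennreal (exp (l * ?Y \<omega>))}"
    using l by (intro arg_cong[where f = "emeasure N"] Collect_cong conj_cong refl)
      (simp add: ennreal_mult'[symmetric] exp_add[symmetric] flip: ennreal_1)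
  also have "\<dots> \<le> ennreal (exp (- l * x)) * (\<integral>\<^sup>+ \<omega>. ennreal (exp (l * ?Y \<omega>)) * indicator (space N) \<omega> \<partial>N)"
    by (rule nn_integral_Markov_inequality) measurable
  also have "(\<integral>\<^sup>+ \<omega>. ennreal (exp (l * ?Y \<omega>)) * indicator (space N) \<omega> \<partial>N)
      = (\<integral>\<^sup>+ \<omega>. ennreal (exp (l * ?Y \<omega>)) \<partial>N)"
    by (intro nn_integral_cong) simp
  also have "\<dots> \<le> ennreal (exp (real m * (2 * l\<^sup>2 * G\<^sup>2 * D\<^sup>2)))"
    unfolding N_def using assms l by (intro ssg_noise_mgf) auto
  also have "\<dots> \<le> ennreal (exp (real t * (2 * l\<^sup>2 * G\<^sup>2 * D\<^sup>2)))"
    using assms(5) by (intro ennreal_leI) (simp add: mult_right_mono)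
  finally have "emeasure N {\<omega>\<in>space N. x \<le> ?Y \<omega>}
      \<le> ennreal (exp (- l * x)) * ennreal (exp (real t * (2 * l\<^sup>2 * G\<^sup>2 * D\<^sup>2)))"
    by (simp add: mult_left_mono)
  also have "\<dots> = ennreal (exp (- (x\<^sup>2 / (8 * real t * G\<^sup>2 * D\<^sup>2))))"
  proof -
    have "- l * x + real t * (2 * l\<^sup>2 * G\<^sup>2 * D\<^sup>2) = - (x\<^sup>2 / (8 * real t * G\<^sup>2 * D\<^sup>2))"
      using assms(3,6) G_pos by (simp add: l_def field_simps power2_eq_square)
    then show ?thesis by (simp add: ennreal_mult'[symmetric] exp_add[symmetric])
  qed
  finally show ?thesis by (simp add: N.emeasure_eq_measure)
qed

end

section \<open>The stages of the algorithm\<close>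

text \<open>Transfers statements about the product measure to the given sample space. The case \<open>J = {}\<close> occurs when
  a stage consists of a single iterate and draws no sample.\<close>

lemma (in prob_space) distr_iid_eq_PiM:
  assumes "indep_vars (\<lambda>_. N) X I" "\<And>i. i \<in> I \<Longrightarrow> distr M N (X i) = N" "J \<subseteq> I" "prob_space N"
  shows "distr M (PiM J (\<lambda>_. N)) (\<lambda>\<omega>. \<lambda>i\<in>J. X i \<omega>) = PiM J (\<lambda>_. N)"
proof (cases "J = {}")
  case False
  have rv: "random_variable N (X i)" if "i \<in> J" for i
    using assms(1,3) that by (auto simp: indep_vars_def)
  have "indep_vars (\<lambda>_. N) X J" using assms(1,3) by (rule indep_vars_subset)
  then have "distr M (PiM J (\<lambda>_. N)) (\<lambda>\<omega>. \<lambda>i\<in>J. X i \<omega>) = PiM J (\<lambda>i. distr M N (X i))"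
    using False rv by (subst (asm) indep_vars_iff_distr_eq_PiM') auto
  also have "\<dots> = PiM J (\<lambda>_. N)" using assms(2,3) by (intro PiM_cong) auto
  finally show ?thesis .
next
  case True
  interpret P: product_prob_space "\<lambda>_. N" J
    using assms(4) by (simp add: product_prob_space_def product_prob_space_axioms_def
        product_sigma_finite_def prob_space_imp_sigma_finite)
  have meas: "(\<lambda>\<omega>. \<lambda>i\<in>J. X i \<omega>) \<in> M \<rightarrow>\<^sub>M PiM J (\<lambda>_. N)" using True by (intro measurable_restrict) auto
  show ?thesis
  proof (rule P.PiM_eqI)
    fix A :: "_ \<Rightarrow> _ set" assume "\<And>i. i \<in> J \<Longrightarrow> A i \<in> sets N"
    then have "Pi\<^sub>E J A \<in> sets (PiM J (\<lambda>_. N))" using True by (intro sets_PiM_I_finite) auto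
    then have "emeasure (distr M (PiM J (\<lambda>_. N)) (\<lambda>\<omega>. \<lambda>i\<in>J. X i \<omega>)) (Pi\<^sub>E J A)
        = emeasure M ((\<lambda>\<omega>. \<lambda>i\<in>J. X i \<omega>) -` Pi\<^sub>E J A \<inter> space M)"
      by (rule emeasure_distr[OF meas])
    also have "(\<lambda>\<omega>. \<lambda>i\<in>J. X i \<omega>) -` Pi\<^sub>E J A \<inter> space M = space M" using True by auto
    also have "emeasure M (space M) = (\<Prod>i\<in>J. emeasure N (A i))"
      using True by (simp add: emeasure_space_1)
    finally show "emeasure (distr M (PiM J (\<lambda>_. N)) (\<lambda>\<omega>. \<lambda>i\<in>J. X i \<omega>)) (Pi\<^sub>E J A)
        = (\<Prod>i\<in>J. emeasure N (A i))" .
  qed (use True in auto)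
qed

context stochastic_subgradients
begin

text \<open>The closest minimizer is the comparison point, but it lies in the ball of the current stage only if the
  previous stages were successful. Falling back to \<open>v\<close> otherwise keeps the noise bounded on the whole
  probability space, so that the tail bound of a stage holds without conditioning on earlier stages.\<close>

definition comparator :: "real \<Rightarrow> 'a \<Rightarrow> 'a" where
  "comparator r v =
     (if norm (v - closest_point (minimizers F) v) \<le> r then closest_point (minimizers F) v else v)"

lemma comparator_dist: "0 \<le> r \<Longrightarrow> norm (v - comparator r v) \<le> r"
  by (simp add: comparator_def)

lemma comparator_measurable:
  assumes "minimizers F \<noteq> {}"
  shows "comparator r \<in> borel_measurable borel"
proof -
  have [measurable]: "closest_point (minimizers F) \<in> borel_measurable borel"
    using closed_convex_minimizers[OF assms F_convex] assms
    by (intro borel_measurable_continuous_onI continuous_on_closest_point)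
  show ?thesis unfolding comparator_def[abs_def] by measurable
qed

lemma assg_stage_measurable:
  assumes "finite J" "{1..k} \<times> {1..<t} \<subseteq> J" "0 \<le> D"
  shows "(\<lambda>\<omega>. assg_stage g t \<eta> D w0 (\<lambda>k \<tau>. \<omega> (k, \<tau>)) k) \<in> borel_measurable (PiM J (\<lambda>_. M))"
  using assms(2)
proof (induction k)
  case (Suc k)
  let ?B = "borel_measurable (PiM J (\<lambda>_. M))"
  let ?v = "\<lambda>\<omega>. assg_stage g t \<eta> D w0 (\<lambda>k \<tau>. \<omega> (k, \<tau>)) k"
  have "?v \<in> ?B" using Suc by (intro Suc.IH) auto
  then have "(\<lambda>\<omega>. ssg_iterate g (\<eta> / 2 ^ k) (D / 2 ^ k) (?v \<omega>) (\<lambda>\<tau>. \<omega> (Suc k, \<tau>)) j) \<in> ?B"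
    if "j < t" for j
    using that Suc.prems assms(1,3) by (intro ssg_iterate_measurable) auto
  then show ?case
    unfolding assg_stage.simps ssg_average_def
    by (intro borel_measurable_scaleR borel_measurable_const borel_measurable_sum) auto
qed simp

lemma assg_stage_random_variable:
  assumes iid: "iid_samples \<Omega> M K t \<xi>" and D: "0 \<le> D"
  shows "(\<lambda>\<omega>. assg_stage g t \<eta> D w0 (\<lambda>k \<tau>. \<xi> k \<tau> \<omega>) K) \<in> borel_measurable \<Omega>"
proof -
  interpret \<Omega>: prob_space \<Omega> using iid by (simp add: iid_samples_def)
  let ?I = "{1..K} \<times> {1..<t}" and ?X = "\<lambda>(k, \<tau>). \<xi> k \<tau>"
  have "(\<lambda>\<omega>. \<lambda>i\<in>?I. ?X i \<omega>) \<in> \<Omega> \<rightarrow>\<^sub>M PiM ?I (\<lambda>_. M)"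
    using iid by (intro measurable_restrict) (auto simp: iid_samples_def \<Omega>.indep_vars_def)
  moreover have "(\<lambda>x. assg_stage g t \<eta> D w0 (\<lambda>k \<tau>. x (k, \<tau>)) K) \<in> borel_measurable (PiM ?I (\<lambda>_. M))"
    using D by (intro assg_stage_measurable) auto
  ultimately have "(\<lambda>\<omega>. assg_stage g t \<eta> D w0 (\<lambda>k \<tau>. (\<lambda>i\<in>?I. ?X i \<omega>) (k, \<tau>)) K) \<in> borel_measurable \<Omega>"
    by (rule measurable_compose)
  moreover have "assg_stage g t \<eta> D w0 (\<lambda>k \<tau>. (\<lambda>i\<in>?I. ?X i \<omega>) (k, \<tau>)) K
      = assg_stage g t \<eta> D w0 (\<lambda>k \<tau>. \<xi> k \<tau> \<omega>) K" for \<omega>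
    by (intro assg_stage_cong) auto
  ultimately show ?thesis by simp
qed

text \<open>The deterministic part: for a fixed realization of the samples in which the noise of every stage stays
  below its threshold, each stage halves the error. The bound for \<open>w k\<close> makes its closest minimizer
  \<open>p\<close> admissible as \<open>comparator\<close>, since \<open>norm (w k - p) \<le> c e \<le> D\<close>; the three terms of
  \<open>ssg_average_regret\<close> are at most \<open>e / 6\<close> each.\<close>

lemma assg_stage_halving:
  fixes \<xi> :: "nat \<Rightarrow> nat \<Rightarrow> 'b"
  assumes "minimizers F \<noteq> {}"
    and growth: "\<And>w. norm (w - closest_point (minimizers F) w) \<le> c * (F w - min_value F)"
    and "0 < c" "0 < \<epsilon>0" "c * \<epsilon>0 \<le> D1" "1 \<le> t" "9 * G\<^sup>2 * D1\<^sup>2 / \<epsilon>0\<^sup>2 \<le> real t"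
    and init: "F w0 - min_value F \<le> \<epsilon>0"
    and samples: "\<And>k \<tau>. k \<in> {1..K} \<Longrightarrow> \<tau> \<in> {1..<t} \<Longrightarrow> \<xi> k \<tau> \<in> space M"
  defines "w \<equiv> assg_stage g t (\<epsilon>0 / (3 * G\<^sup>2)) D1 w0 \<xi>"
  assumes noise: "\<And>k. k < K \<Longrightarrow>
      ssg_noise (\<epsilon>0 / (3 * G\<^sup>2) / 2 ^ k) (D1 / 2 ^ k) (comparator (D1 / 2 ^ k) (w k)) (w k) (\<xi> (Suc k)) (t - 1)
        < real t * (\<epsilon>0 / 2 ^ k) / 6"
    and "k \<le> K"
  shows "F (w k) - min_value F \<le> \<epsilon>0 / 2 ^ k"
  using \<open>k \<le> K\<close>
proof (induction k)
  case 0
  then show ?case using init by (simp add: w_def)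
next
  case (Suc k)
  let ?S = "minimizers F"
  define e where "e = \<epsilon>0 / 2 ^ k"
  define D where "D = D1 / 2 ^ k"
  define \<eta> where "\<eta> = e / (3 * G\<^sup>2)"
  define p where "p = closest_point ?S (w k)"
  have \<eta>_eq: "\<epsilon>0 / (3 * G\<^sup>2) / 2 ^ k = \<eta>" by (simp add: \<eta>_def e_def)
  have pos: "0 < e" "0 < D" "0 < \<eta>"
    using assms(4,5) G_pos mult_pos_pos[OF assms(3,4)] by (auto simp: e_def D_def \<eta>_def)
  have "c * e \<le> D" using assms(5) by (simp add: e_def D_def divide_right_mono)
  have IH: "F (w k) - min_value F \<le> e" using Suc by (simp add: e_def)
  have "norm (w k - p) \<le> c * (F (w k) - min_value F)" unfolding p_def by (rule growth)
  also have "\<dots> \<le> c * e" using IH assms(3) by (intro mult_left_mono) auto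
  also note \<open>c * e \<le> D\<close>
  finally have dist: "norm (w k - p) \<le> D" .
  then have cmp: "comparator D (w k) = p" by (simp add: comparator_def p_def)
  have "p \<in> ?S" unfolding p_def
    using closed_convex_minimizers(1)[OF assms(1) F_convex] assms(1) by (rule closest_point_in_set)
  then have Fp: "F p = min_value F" by (rule minimizers_value)
  let ?Y = "ssg_noise \<eta> D p (w k) (\<xi> (Suc k)) (t - 1)"
  have "F (ssg_average g t \<eta> D (w k) (\<xi> (Suc k))) - F p
      \<le> \<eta> * G\<^sup>2 / 2 + D\<^sup>2 / (2 * \<eta> * real t) + ?Y / real t"
    using pos dist Suc.prems samples assms(6) by (intro ssg_average_regret) auto
  also have "ssg_average g t \<eta> D (w k) (\<xi> (Suc k)) = w (Suc k)"
    by (simp add: w_def \<eta>_eq D_def del: divide_divide_eq_left)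
  also have "\<eta> * G\<^sup>2 / 2 = e / 6" using G_pos by (simp add: \<eta>_def)
  also have "D\<^sup>2 / (2 * \<eta> * real t) \<le> e / 6"
  proof -
    have "9 * G\<^sup>2 * D\<^sup>2 / e\<^sup>2 = 9 * G\<^sup>2 * D1\<^sup>2 / \<epsilon>0\<^sup>2" by (simp add: D_def e_def power_divide)
    with assms(7) have "9 * G\<^sup>2 * D\<^sup>2 / e\<^sup>2 \<le> real t" by (simp only:)
    then have "9 * G\<^sup>2 * D\<^sup>2 \<le> real t * e\<^sup>2" using pos by (subst (asm) pos_divide_le_eq) auto
    then show ?thesis using pos G_pos assms(6)
      by (simp add: \<eta>_def pos_divide_le_eq field_simps power2_eq_square)
  qed
  also have "?Y / real t \<le> e / 6"
    using noise[of k] Suc.prems assms(6)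
    by (simp add: \<eta>_eq cmp flip: D_def e_def del: divide_divide_eq_left) (simp add: pos_divide_le_eq mult.commute)
  finally show ?case by (simp add: Fp e_def)
qed

text \<open>Stage \<open>k + 1\<close> fails if its noise reaches \<open>t e / 6\<close> with \<open>e = \<epsilon>0 / 2^k\<close>. As \<open>D / e = D1 / \<epsilon>0\<close> in every
  stage, the tail bound is \<open>exp (- t \<epsilon>0\<^sup>2 / (288 G\<^sup>2 D1\<^sup>2))\<close>, and \<open>t\<close> is large enough for the exponent to be
  at most \<open>- 6 ln (K / \<delta>)\<close>. So each stage fails with probability at most \<open>\<delta> / K\<close>.\<close>

theorem assg_high_probability:
  fixes \<Omega> :: "'c measure" and \<xi> :: "nat \<Rightarrow> nat \<Rightarrow> 'c \<Rightarrow> 'b"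
  assumes min: "minimizers F \<noteq> {}"
    and growth: "\<And>w. norm (w - closest_point (minimizers F) w) \<le> c * (F w - min_value F)"
    and c: "0 < c" and \<epsilon>0: "0 < \<epsilon>0" and D1: "c * \<epsilon>0 \<le> D1"
    and t: "9 * G\<^sup>2 * D1\<^sup>2 / \<epsilon>0\<^sup>2 \<le> real t"
      "1728 * ln (real K / \<delta>) * G\<^sup>2 * D1\<^sup>2 / \<epsilon>0\<^sup>2 \<le> real t"
    and K: "1 \<le> K" and \<delta>: "0 < \<delta>" "\<delta> < 1"
    and iid: "iid_samples \<Omega> M K t \<xi>"
    and init: "F w0 - min_value F \<le> \<epsilon>0"
  shows "1 - \<delta> \<le> measure \<Omega> {\<omega>\<in>space \<Omega>.
    F (assg_stage g t (\<epsilon>0 / (3 * G\<^sup>2)) D1 w0 (\<lambda>k \<tau>. \<xi> k \<tau> \<omega>) K) - min_value F \<le> \<epsilon>0 / 2 ^ K}"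
proof -
  interpret \<Omega>: prob_space \<Omega> using iid by (simp add: iid_samples_def)
  define \<eta> where "\<eta> = \<epsilon>0 / (3 * G\<^sup>2)"
  let ?I = "{1..K} \<times> {1..<t}"
  let ?X = "\<lambda>(k, \<tau>). \<xi> k \<tau>"
  define T where "T J \<omega> = (\<lambda>i\<in>J. ?X i \<omega>)" for J \<omega>
  have indep: "\<Omega>.indep_vars (\<lambda>_. M) ?X ?I" using iid by (simp add: iid_samples_def)
  have rv: "?X i \<in> \<Omega> \<rightarrow>\<^sub>M M" if "i \<in> ?I" for i using indep that by (auto simp: \<Omega>.indep_vars_def)
  have T_meas: "T J \<in> \<Omega> \<rightarrow>\<^sub>M PiM J (\<lambda>_. M)" if "J \<subseteq> ?I" for J
    unfolding T_def[abs_def] using that rv by (intro measurable_restrict) blast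
  have T_law: "distr \<Omega> (PiM J (\<lambda>_. M)) (T J) = PiM J (\<lambda>_. M)" if "J \<subseteq> ?I" for J
    unfolding T_def[abs_def] using iid that
    by (intro \<Omega>.distr_iid_eq_PiM[OF indep]) (auto simp: iid_samples_def prob_space_axioms)
  have D1_pos: "0 < D1" using D1 mult_pos_pos[OF c \<epsilon>0] by simp
  have "0 < 9 * G\<^sup>2 * D1\<^sup>2 / \<epsilon>0\<^sup>2" using G_pos D1_pos \<epsilon>0 by simp
  then have t1: "1 \<le> t" using t(1) by (cases t) auto

  \<comment> \<open>\<open>start k\<close> is the starting point of stage \<open>k + 1\<close> as a function of the array of samples, \<open>Z k\<close> the noise of
    that stage, and \<open>past k\<close> the set of samples drawn before it.\<close>
  define start where "start k x = assg_stage g t \<eta> D1 w0 (\<lambda>k \<tau>. x (k, \<tau>)) k" for k and x :: "nat \<times> nat \<Rightarrow> 'b"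
  define Z where "Z k x = ssg_noise (\<eta> / 2 ^ k) (D1 / 2 ^ k) (comparator (D1 / 2 ^ k) (start k x)) (start k x)
      (\<lambda>\<tau>. x (Suc k, \<tau>)) (t - 1)" for k x
  define past where "past k = {1..k} \<times> {1..<t}" for k :: nat
  have start_meas: "start k \<in> borel_measurable (PiM J (\<lambda>_. M))" if "finite J" "past k \<subseteq> J" for k J
    unfolding start_def[abs_def] using that D1_pos by (intro assg_stage_measurable) (auto simp: past_def)
  have start_cong: "start k x = start k x'" if "\<And>i. i \<in> past k \<Longrightarrow> x i = x' i" for k x x'
    unfolding start_def using that by (intro assg_stage_cong) (auto simp: past_def)

  define bad where "bad k = {\<omega>\<in>space \<Omega>. real t * (\<epsilon>0 / 2 ^ k) / 6 \<le> Z k (T ?I \<omega>)}" for k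
  have bad: "bad k \<in> sets \<Omega>" "measure \<Omega> (bad k) \<le> \<delta> / real K" if k: "k < K" for k
  proof -
    let ?J = "past k \<union> {Suc k} \<times> {1..t - 1}"
    let ?N = "PiM ?J (\<lambda>_. M)"
    let ?x = "real t * (\<epsilon>0 / 2 ^ k) / 6" and ?D = "D1 / 2 ^ k"
    let ?A = "{y\<in>space ?N. ?x \<le> Z k y}"
    have J: "?J \<subseteq> ?I" "finite (past k)" "finite ?J" using k by (auto simp: past_def)
    have Z_meas: "Z k \<in> borel_measurable ?N"
      unfolding Z_def[abs_def] using J D1_pos
      by (intro ssg_noise_measurable start_meas measurable_compose[OF start_meas comparator_measurable[OF min]]) auto
    then have A: "?A \<in> sets ?N" by measurable
    have "Z k (T ?I \<omega>) = Z k (T ?J \<omega>)" for \<omega>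
    proof -
      have "start k (T ?I \<omega>) = start k (T ?J \<omega>)"
        using J(1) by (intro start_cong) (auto simp: T_def)
      moreover have "ssg_noise a b u v (\<lambda>\<tau>. T ?I \<omega> (Suc k, \<tau>)) (t - 1)
          = ssg_noise a b u v (\<lambda>\<tau>. T ?J \<omega> (Suc k, \<tau>)) (t - 1)" for a b u v
        unfolding ssg_noise_def
      proof (intro sum.cong refl)
        fix j assume j: "j \<in> {..<t - 1}"
        have eq: "T ?I \<omega> (Suc k, \<tau>) = T ?J \<omega> (Suc k, \<tau>)" if "\<tau> \<in> {1..t - 1}" for \<tau>
          using that k by (auto simp: T_def)
        have "ssg_iterate g a b v (\<lambda>\<tau>. T ?I \<omega> (Suc k, \<tau>)) j = ssg_iterate g a b v (\<lambda>\<tau>. T ?J \<omega> (Suc k, \<tau>)) j"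
          using j by (intro ssg_iterate_cong eq) auto
        with eq[of "Suc j"] j
        show "noise u (ssg_iterate g a b v (\<lambda>\<tau>. T ?I \<omega> (Suc k, \<tau>)) j) (T ?I \<omega> (Suc k, Suc j))
          = noise u (ssg_iterate g a b v (\<lambda>\<tau>. T ?J \<omega> (Suc k, \<tau>)) j) (T ?J \<omega> (Suc k, Suc j))" by simp
      qed
      ultimately show ?thesis by (simp add: Z_def)
    qed
    then have bad_eq: "bad k = T ?J -` ?A \<inter> space \<Omega>"
      using measurable_space[OF T_meas[OF J(1)]] by (auto simp: bad_def)
    show "bad k \<in> sets \<Omega>" unfolding bad_eq by (rule measurable_sets[OF T_meas[OF J(1)] A])
    have "measure \<Omega> (bad k) = measure (distr \<Omega> ?N (T ?J)) ?A"
      unfolding bad_eq by (rule measure_distr[symmetric, OF T_meas[OF J(1)] A])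
    also have "\<dots> = measure ?N ?A" by (simp only: T_law[OF J(1)])
    also have "\<dots> \<le> exp (- (?x\<^sup>2 / (8 * real t * G\<^sup>2 * ?D\<^sup>2)))"
      unfolding Z_def
    proof (rule ssg_noise_tail)
      show "start k (fun_upd \<omega> i s) = start k \<omega>" if "fst i = Suc k" for \<omega> i s
        using that by (intro start_cong) (auto simp: past_def)
      then show "comparator ?D (start k (fun_upd \<omega> i s)) = comparator ?D (start k \<omega>)"
        if "fst i = Suc k" for \<omega> i s
        using that by simp
      show "norm (start k \<omega> - comparator ?D (start k \<omega>)) \<le> ?D" for \<omega>
        using D1_pos by (intro comparator_dist) simp
    qed (use J D1_pos \<epsilon>0 t1 start_meas measurable_compose[OF start_meas comparator_measurable[OF min]]
      in \<open>auto simp: past_def\<close>)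
    also have "\<dots> \<le> exp (- ln (real K / \<delta>))"
    proof -
      have L: "0 \<le> ln (real K / \<delta>)" using K \<delta> by (intro ln_ge_zero) (simp add: field_simps)
      define q where "q = real t * \<epsilon>0\<^sup>2 / (G\<^sup>2 * D1\<^sup>2)"
      have "1728 * ln (real K / \<delta>) \<le> q"
        using t(2) \<epsilon>0 G_pos D1_pos by (simp add: q_def field_simps)
      moreover have "?x\<^sup>2 / (8 * real t * G\<^sup>2 * ?D\<^sup>2) = q / 288"
        using t1 by (simp add: q_def power_divide power_mult_distrib power2_eq_square mult_ac)
      ultimately have "ln (real K / \<delta>) \<le> ?x\<^sup>2 / (8 * real t * G\<^sup>2 * ?D\<^sup>2)" using L by linarith
      then show ?thesis by (simp only: exp_le_cancel_iff neg_le_iff_le)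
    qed
    also have "\<dots> = \<delta> / real K" using K \<delta> by (simp add: exp_minus)
    finally show "measure \<Omega> (bad k) \<le> \<delta> / real K" .
  qed

  define good where "good = {\<omega>\<in>space \<Omega>.
    F (assg_stage g t (\<epsilon>0 / (3 * G\<^sup>2)) D1 w0 (\<lambda>k \<tau>. \<xi> k \<tau> \<omega>) K) - min_value F \<le> \<epsilon>0 / 2 ^ K}"
  have "(\<lambda>\<omega>. F (assg_stage g t (\<epsilon>0 / (3 * G\<^sup>2)) D1 w0 (\<lambda>k \<tau>. \<xi> k \<tau> \<omega>) K)) \<in> borel_measurable \<Omega>"
    using D1_pos
    by (intro measurable_compose[OF assg_stage_random_variable[OF iid] F_measurable]) simp
  then have good: "good \<in> sets \<Omega>" unfolding good_def by measurable
  have T_start: "assg_stage g t (\<epsilon>0 / (3 * G\<^sup>2)) D1 w0 (\<lambda>k \<tau>. T ?I \<omega> (k, \<tau>)) K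
      = assg_stage g t (\<epsilon>0 / (3 * G\<^sup>2)) D1 w0 (\<lambda>k \<tau>. \<xi> k \<tau> \<omega>) K" for \<omega>
    by (intro assg_stage_cong) (auto simp: T_def)
  have "space \<Omega> - (\<Union>k<K. bad k) \<subseteq> good"
  proof
    fix \<omega> assume \<omega>: "\<omega> \<in> space \<Omega> - (\<Union>k<K. bad k)"
    have "F (assg_stage g t (\<epsilon>0 / (3 * G\<^sup>2)) D1 w0 (\<lambda>k \<tau>. T ?I \<omega> (k, \<tau>)) K) - min_value F \<le> \<epsilon>0 / 2 ^ K"
    proof (rule assg_stage_halving[OF min growth c \<epsilon>0 D1 t1 t(1) init])
      fix k \<tau> assume "k \<in> {1..K}" "\<tau> \<in> {1..<t}"
      then show "T ?I \<omega> (k, \<tau>) \<in> space M"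
        using measurable_space[OF rv[of "(k, \<tau>)"], of \<omega>] \<omega> by (auto simp: T_def)
    next
      fix k assume "k < K"
      then have "Z k (T ?I \<omega>) < real t * (\<epsilon>0 / 2 ^ k) / 6" using \<omega> by (auto simp: bad_def not_le)
      then show "ssg_noise (\<epsilon>0 / (3 * G\<^sup>2) / 2 ^ k) (D1 / 2 ^ k)
          (comparator (D1 / 2 ^ k) (assg_stage g t (\<epsilon>0 / (3 * G\<^sup>2)) D1 w0 (\<lambda>k \<tau>. T ?I \<omega> (k, \<tau>)) k))
          (assg_stage g t (\<epsilon>0 / (3 * G\<^sup>2)) D1 w0 (\<lambda>k \<tau>. T ?I \<omega> (k, \<tau>)) k)
          (\<lambda>\<tau>. T ?I \<omega> (Suc k, \<tau>)) (t - 1) < real t * (\<epsilon>0 / 2 ^ k) / 6"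
        by (simp only: Z_def start_def \<eta>_def)
    qed simp
    then show "\<omega> \<in> good" using \<omega> unfolding T_start good_def by blast
  qed
  then have "1 - measure \<Omega> (\<Union>k<K. bad k) \<le> measure \<Omega> good"
    using bad(1) good by (subst \<Omega>.prob_compl[symmetric]) (auto intro!: \<Omega>.finite_measure_mono)
  moreover have "measure \<Omega> (\<Union>k<K. bad k) \<le> (\<Sum>k<K. measure \<Omega> (bad k))"
    using bad(1) by (intro \<Omega>.finite_measure_subadditive_finite) auto
  moreover have "(\<Sum>k<K. measure \<Omega> (bad k)) \<le> (\<Sum>k<K. \<delta> / real K)"
    using bad(2) by (intro sum_mono) simp
  moreover have "(\<Sum>k<K. \<delta> / real K) = \<delta>" using K by simp
  ultimately show ?thesis by (simp add: good_def)
qed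

end

lemma assg_K_bounds:
  assumes "0 < \<epsilon>" "\<epsilon> < \<epsilon>0"
  shows "1 \<le> assg_K \<epsilon>0 \<epsilon>" "\<epsilon>0 / 2 ^ assg_K \<epsilon>0 \<epsilon> \<le> \<epsilon>"
proof -
  have pos: "0 < log 2 (\<epsilon>0 / \<epsilon>)" using assms by (simp add: zero_less_log_cancel_iff)
  then show "1 \<le> assg_K \<epsilon>0 \<epsilon>" by (simp add: assg_K_def Suc_le_eq)
  have "log 2 (\<epsilon>0 / \<epsilon>) \<le> real (assg_K \<epsilon>0 \<epsilon>)" unfolding assg_K_def by (rule real_nat_ceiling_ge)
  then have "\<epsilon>0 / \<epsilon> \<le> 2 ^ assg_K \<epsilon>0 \<epsilon>"
    using assms by (simp add: log_le_iff powr_realpow)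
  then show "\<epsilon>0 / 2 ^ assg_K \<epsilon>0 \<epsilon> \<le> \<epsilon>" using assms by (simp add: field_simps)
qed

lemma assg_succeeds_of_growth:
  fixes F :: "'a::euclidean_space \<Rightarrow> real"
  assumes min: "minimizers F \<noteq> {}"
    and growth: "\<And>w. norm (w - closest_point (minimizers F) w) \<le> c * (F w - min_value F)"
    and "0 < c" "0 < G" "0 < \<epsilon>" "\<epsilon> < \<epsilon>0" "0 < \<delta>" "\<delta> < 1" "c * \<epsilon>0 \<le> D1"
  shows "assg_succeeds TYPE('b) TYPE('c) F G \<epsilon>0 \<epsilon> \<delta> D1"
  unfolding assg_succeeds_def
proof (intro allI impI, elim conjE)
  fix M :: "'b measure" and f :: "'a \<Rightarrow> 'b \<Rightarrow> real" and g :: "'a \<Rightarrow> 'b \<Rightarrow> 'a"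
    and \<Omega> :: "'c measure" and \<xi> :: "nat \<Rightarrow> nat \<Rightarrow> 'c \<Rightarrow> 'b" and w0 :: 'a
  let ?K = "assg_K \<epsilon>0 \<epsilon>" and ?t = "assg_t G \<epsilon>0 \<epsilon> \<delta> D1"
  let ?w = "\<lambda>\<omega>. assg_output g G \<epsilon>0 \<epsilon> \<delta> D1 w0 (\<lambda>k \<tau>. \<xi> k \<tau> \<omega>)"
  assume "stochastic_problem M f g F G" and iid: "iid_samples \<Omega> M ?K ?t \<xi>"
    and init: "F w0 - min_value F \<le> \<epsilon>0"
  then interpret stochastic_subgradients M f g F G using assms(4) by unfold_locales
  interpret \<Omega>: prob_space \<Omega> using iid by (simp add: iid_samples_def)
  note K = assg_K_bounds[OF assms(5,6)]
  let ?L = "ln (real ?K / \<delta>)"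
  have t: "a * G\<^sup>2 * D1\<^sup>2 / \<epsilon>0\<^sup>2 \<le> real ?t" if "a \<le> max 9 (1728 * ?L)" for a
  proof -
    have "a * G\<^sup>2 * D1\<^sup>2 / \<epsilon>0\<^sup>2 \<le> max 9 (1728 * ?L) * G\<^sup>2 * D1\<^sup>2 / \<epsilon>0\<^sup>2"
      using that by (intro divide_right_mono mult_right_mono) auto
    also have "\<dots> \<le> real ?t" unfolding assg_t_def assg_delta_def by (simp add: real_nat_ceiling_ge)
    finally show ?thesis .
  qed
  have "1 - \<delta> \<le> measure \<Omega> {\<omega>\<in>space \<Omega>. F (?w \<omega>) - min_value F \<le> \<epsilon>0 / 2 ^ ?K}"
    unfolding assg_output_def
    using assms(3,5-9) K(1) iid init t[of 9] t[of "1728 * ?L"]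
    by (intro assg_high_probability[OF min growth]) (auto simp: mult.assoc)
  also have "\<dots> \<le> measure \<Omega> {\<omega>\<in>space \<Omega>. F (?w \<omega>) - min_value F \<le> 2 * \<epsilon>}"
  proof (rule \<Omega>.finite_measure_mono)
    show "{\<omega>\<in>space \<Omega>. F (?w \<omega>) - min_value F \<le> \<epsilon>0 / 2 ^ ?K}
        \<subseteq> {\<omega>\<in>space \<Omega>. F (?w \<omega>) - min_value F \<le> 2 * \<epsilon>}"
      using K(2) assms(5) by auto
    have "(\<lambda>\<omega>. F (?w \<omega>)) \<in> borel_measurable \<Omega>"
      unfolding assg_output_def using mult_pos_pos[OF assms(3), of \<epsilon>0] assms(5,6,9)
      by (intro measurable_compose[OF assg_stage_random_variable[OF iid] F_measurable]) auto
    then show "{\<omega>\<in>space \<Omega>. F (?w \<omega>) - min_value F \<le> 2 * \<epsilon>} \<in> sets \<Omega>" by measurable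
  qed
  finally show "1 - \<delta> \<le> measure \<Omega> {\<omega>\<in>space \<Omega>. F (?w \<omega>) - min_value F \<le> 2 * \<epsilon>}" .
qed

section \<open>The iteration count\<close>

lemma real_nat_ceiling_le_add_one: "0 \<le> r \<Longrightarrow> real (nat \<lceil>r\<rceil>) \<le> r + 1"
  by linarith

text \<open>For \<open>\<epsilon> \<le> \<epsilon>0 / 2\<close> and \<open>\<delta> \<le> 1 / 2\<close> both logarithms are bounded away from 0, which absorbs the rounding in
  \<open>K\<close> and \<open>t\<close> and the alternative 9 in the maximum.\<close>

lemma assg_iterations_le:
  assumes "0 < \<epsilon>" "\<epsilon> \<le> \<epsilon>0 / 2" "0 < \<delta>" "\<delta> \<le> 1 / 2" "0 \<le> D1" "D1 \<le> b * (c * \<epsilon>0)"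
  shows "real (assg_iterations G \<epsilon>0 \<epsilon> \<delta> D1)
    \<le> 4 * (1728 * G\<^sup>2 * (b * c)\<^sup>2 + 2) * ln (1 / assg_delta \<epsilon>0 \<epsilon> \<delta>) * ln (\<epsilon>0 / \<epsilon>)"
proof -
  define L where "L = ln (1 / assg_delta \<epsilon>0 \<epsilon> \<delta>)"
  define K where "K = assg_K \<epsilon>0 \<epsilon>"
  have \<epsilon>: "\<epsilon> < \<epsilon>0" "0 < \<epsilon>0" "2 \<le> \<epsilon>0 / \<epsilon>" using assms by (auto simp: field_simps)
  have ln2: "1 / 2 \<le> ln (2 :: real)" using ln2_ge_two_thirds by simp
  have K1: "1 \<le> K" unfolding K_def by (rule assg_K_bounds(1)[OF assms(1) \<epsilon>(1)])
  have "2 \<le> real K / \<delta>" using K1 assms(3,4) by (simp add: field_simps)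
  then have "ln 2 \<le> ln (real K / \<delta>)" using assms(3) by (intro ln_mono) auto
  also have "ln (real K / \<delta>) = L" by (simp add: L_def assg_delta_def K_def)
  finally have L: "1 / 2 \<le> L" using ln2 by linarith
  have log: "1 \<le> log 2 (\<epsilon>0 / \<epsilon>)" using \<epsilon> assms(1) by (simp add: le_log_iff)
  have "real K \<le> log 2 (\<epsilon>0 / \<epsilon>) + 1" unfolding K_def assg_K_def
    using log by (intro real_nat_ceiling_le_add_one) simp
  also have "\<dots> \<le> 2 * log 2 (\<epsilon>0 / \<epsilon>)" using log by simp
  also have "\<dots> \<le> 4 * ln (\<epsilon>0 / \<epsilon>)"
  proof -
    have "0 \<le> ln (\<epsilon>0 / \<epsilon>)" using \<epsilon>(3) by (intro ln_ge_zero) simp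
    then have "ln (\<epsilon>0 / \<epsilon>) * 1 \<le> ln (\<epsilon>0 / \<epsilon>) * (2 * ln 2)" using ln2 by (intro mult_left_mono) auto
    then show ?thesis by (simp add: log_def field_simps)
  qed
  finally have K: "real K \<le> 4 * ln (\<epsilon>0 / \<epsilon>)" .
  have "D1\<^sup>2 \<le> (b * (c * \<epsilon>0))\<^sup>2" using assms(5,6) by (intro power_mono)
  then have D: "D1\<^sup>2 / \<epsilon>0\<^sup>2 \<le> (b * c)\<^sup>2" using \<epsilon>(2) by (simp add: pos_divide_le_eq power_mult_distrib mult.assoc)
  have "max 9 (1728 * L) = 1728 * L" using L by simp
  then have t_eq: "assg_t G \<epsilon>0 \<epsilon> \<delta> D1 = nat \<lceil>1728 * L * G\<^sup>2 * D1\<^sup>2 / \<epsilon>0\<^sup>2\<rceil>"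
    by (simp add: assg_t_def L_def)
  have "real (assg_t G \<epsilon>0 \<epsilon> \<delta> D1) \<le> 1728 * L * G\<^sup>2 * D1\<^sup>2 / \<epsilon>0\<^sup>2 + 1"
    unfolding t_eq using L by (intro real_nat_ceiling_le_add_one) simp
  also have "1728 * L * G\<^sup>2 * D1\<^sup>2 / \<epsilon>0\<^sup>2 \<le> 1728 * L * G\<^sup>2 * (b * c)\<^sup>2"
    using mult_left_mono[OF D, of "1728 * L * G\<^sup>2"] L by simp
  also have "1728 * L * G\<^sup>2 * (b * c)\<^sup>2 + 1 \<le> (1728 * G\<^sup>2 * (b * c)\<^sup>2 + 2) * L"
    using L by (simp add: algebra_simps)
  finally have t: "real (assg_t G \<epsilon>0 \<epsilon> \<delta> D1) \<le> (1728 * G\<^sup>2 * (b * c)\<^sup>2 + 2) * L" by simp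
  have "real (assg_iterations G \<epsilon>0 \<epsilon> \<delta> D1) = real K * real (assg_t G \<epsilon>0 \<epsilon> \<delta> D1)"
    by (simp add: assg_iterations_def K_def)
  also have "\<dots> \<le> 4 * ln (\<epsilon>0 / \<epsilon>) * ((1728 * G\<^sup>2 * (b * c)\<^sup>2 + 2) * L)"
    using K t by (intro mult_mono) auto
  finally show ?thesis by (simp only: L_def mult_ac)
qed

section \<open>Growth and iteration complexity of the regularized risk\<close>

theorem corollary17:
  fixes x :: "nat \<Rightarrow> real ^ 'd" and y :: "nat \<Rightarrow> 'y" and loss :: "real \<Rightarrow> 'y \<Rightarrow> real"
    and reg :: real and R :: "real ^ 'd \<Rightarrow> real" and n :: nat
  defines "F \<equiv> regularized_risk n x y loss reg R"
  assumes "n \<ge> 1" and "reg \<ge> 0"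
    and "\<And>y. convex_on UNIV (\<lambda>z. loss z y)"
    and "\<And>y. piecewise_linear (\<lambda>z. loss z y)"
    and "R = l1_norm \<or> R = infnorm \<or> (\<exists>\<B>. partition_on UNIV \<B> \<and> R = l1inf_norm \<B>)"
    and "minimizers F \<noteq> {}"
  shows
    "(\<forall>\<epsilon>>0. \<exists>c>0. local_growth F 1 c \<epsilon>) \<and>
     (\<exists>G>0. \<forall>g. (\<forall>w. \<forall>i\<in>{1..n}. g w i \<in> subdifferential (\<lambda>u. loss (u \<bullet> x i) (y i) + reg * R u) w) \<longrightarrow>
        stochastic_problem (uniform_count_measure {1..n})
          (\<lambda>w i. loss (w \<bullet> x i) (y i) + reg * R w) g F G) \<and>
     (\<forall>\<epsilon>' c G b a. 0 < \<epsilon>' \<and> 0 < c \<and> local_growth F 1 c \<epsilon>' \<and> 0 < G \<and> 1 \<le> b \<and> 0 \<le> a \<longrightarrow>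
        (\<exists>C>0. \<forall>\<epsilon> \<epsilon>0 \<delta> D1.
           0 < \<epsilon> \<and> \<epsilon> \<le> \<epsilon>' \<and> \<epsilon> < \<epsilon>0 \<and> 0 < \<delta> \<and> \<delta> < 1 \<and> c * \<epsilon>0 \<le> D1 \<and> D1 \<le> b * (c * \<epsilon>0) \<longrightarrow>
             assg_succeeds TYPE('b) TYPE('c) F G \<epsilon>0 \<epsilon> \<delta> D1 \<and>
             (\<epsilon> \<le> \<epsilon>0 / 2 \<and> \<delta> \<le> 1 / 2 \<longrightarrow>
                real (assg_iterations G \<epsilon>0 \<epsilon> \<delta> D1)
                  \<le> C * ln (1 / assg_delta \<epsilon>0 \<epsilon> \<delta>) * ln (\<epsilon>0 / \<epsilon>)) \<and>
             (\<epsilon> \<le> \<epsilon>0 / 2 \<and> \<delta> \<le> 1 / 2 \<and> ln (real (assg_K \<epsilon>0 \<epsilon>)) \<le> a * ln (1 / \<delta>) \<longrightarrow>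
                real (assg_iterations G \<epsilon>0 \<epsilon> \<delta> D1) \<le> C * ln (1 / \<delta>) * ln (\<epsilon>0 / \<epsilon>))))"
proof (intro conjI)
  define h where "h i w = loss (w \<bullet> x i) (y i) + reg * R w" for i w
  have "max_affine R"
    using assms(6) max_affine_l1_norm max_affine_infnorm max_affine_l1inf_norm by blast
  moreover have "max_affine (\<lambda>w. loss (w \<bullet> x i) (y i))" for i
    by (intro max_affine_compose_inner[of "\<lambda>z. loss z (y i)"] convex_piecewise_linear_imp_max_affine assms(4,5))
  ultimately have h: "max_affine (h i)" for i
    unfolding h_def[abs_def] using assms(3) by (intro max_affine_add max_affine_scale)
  have F_eq: "F = (\<lambda>w. (1 / real n) * (\<Sum>i=1..n. h i w))"
    using assms(2) by (simp add: F_def regularized_risk_def[abs_def] h_def sum.distrib distrib_left add_divide_distrib)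
  have F: "max_affine F"
    unfolding F_eq by (intro max_affine_scale max_affine_sum h) simp
  show "\<forall>\<epsilon>>0. \<exists>c>0. local_growth F 1 c \<epsilon>"
  proof (intro allI impI)
    fix \<epsilon> :: real
    obtain c where "0 < c" "\<And>w. norm (w - closest_point (minimizers F) w) \<le> c * (F w - min_value F)"
      by (metis max_affine_growth[OF F assms(7)])
    then show "\<exists>c>0. local_growth F 1 c \<epsilon>"
      using minimizers_eq_sublevel(2)[OF assms(7)] by (auto simp: local_growth_def)
  qed
  show "\<exists>G>0. \<forall>g. (\<forall>w. \<forall>i\<in>{1..n}. g w i \<in> subdifferential (\<lambda>u. loss (u \<bullet> x i) (y i) + reg * R u) w) \<longrightarrow>
        stochastic_problem (uniform_count_measure {1..n})
          (\<lambda>w i. loss (w \<bullet> x i) (y i) + reg * R w) g F G"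
    unfolding F_eq h_def[symmetric]
  proof (rule stochastic_problem_uniform[OF assms(2) h])
    fix G :: real
    assume "0 < G" and
      G: "\<And>g. (\<forall>w. \<forall>i\<in>{1..n}. g w i \<in> subdifferential (h i) w) \<Longrightarrow>
        stochastic_problem (uniform_count_measure {1..n}) (\<lambda>w i. h i w) g
          (\<lambda>w. (1 / real n) * (\<Sum>i=1..n. h i w)) G"
    show "\<exists>G>0. \<forall>g. (\<forall>w. \<forall>i\<in>{1..n}. g w i \<in> subdifferential (\<lambda>u. h i u) w) \<longrightarrow>
        stochastic_problem (uniform_count_measure {1..n}) (\<lambda>w i. h i w) g
          (\<lambda>w. (1 / real n) * (\<Sum>i=1..n. h i w)) G"
      using \<open>0 < G\<close> G by blast
  qed
  show "\<forall>\<epsilon>' c G b a. 0 < \<epsilon>' \<and> 0 < c \<and> local_growth F 1 c \<epsilon>' \<and> 0 < G \<and> 1 \<le> b \<and> 0 \<le> a \<longrightarrow>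
        (\<exists>C>0. \<forall>\<epsilon> \<epsilon>0 \<delta> D1.
           0 < \<epsilon> \<and> \<epsilon> \<le> \<epsilon>' \<and> \<epsilon> < \<epsilon>0 \<and> 0 < \<delta> \<and> \<delta> < 1 \<and> c * \<epsilon>0 \<le> D1 \<and> D1 \<le> b * (c * \<epsilon>0) \<longrightarrow>
             assg_succeeds TYPE('b) TYPE('c) F G \<epsilon>0 \<epsilon> \<delta> D1 \<and>
             (\<epsilon> \<le> \<epsilon>0 / 2 \<and> \<delta> \<le> 1 / 2 \<longrightarrow>
                real (assg_iterations G \<epsilon>0 \<epsilon> \<delta> D1)
                  \<le> C * ln (1 / assg_delta \<epsilon>0 \<epsilon> \<delta>) * ln (\<epsilon>0 / \<epsilon>)) \<and>
             (\<epsilon> \<le> \<epsilon>0 / 2 \<and> \<delta> \<le> 1 / 2 \<and> ln (real (assg_K \<epsilon>0 \<epsilon>)) \<le> a * ln (1 / \<delta>) \<longrightarrow>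
                real (assg_iterations G \<epsilon>0 \<epsilon> \<delta> D1) \<le> C * ln (1 / \<delta>) * ln (\<epsilon>0 / \<epsilon>)))"
  proof (intro allI impI, elim conjE)
    fix \<epsilon>' c G b a :: real
    assume *: "0 < \<epsilon>'" "0 < c" "local_growth F 1 c \<epsilon>'" "0 < G" "1 \<le> b" "0 \<le> a"
    have growth: "norm (w - closest_point (minimizers F) w) \<le> c * (F w - min_value F)" for w
      using *(1,2,3) by (intro local_growth_imp_global[OF max_affine_imp_convex_on[OF F] assms(7)]) auto
    define C0 where "C0 = 4 * (1728 * G\<^sup>2 * (b * c)\<^sup>2 + 2)"
    have C0: "0 < C0" by (simp add: C0_def add_nonneg_pos)
    show "\<exists>C>0. \<forall>\<epsilon> \<epsilon>0 \<delta> D1.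
           0 < \<epsilon> \<and> \<epsilon> \<le> \<epsilon>' \<and> \<epsilon> < \<epsilon>0 \<and> 0 < \<delta> \<and> \<delta> < 1 \<and> c * \<epsilon>0 \<le> D1 \<and> D1 \<le> b * (c * \<epsilon>0) \<longrightarrow>
             assg_succeeds TYPE('b) TYPE('c) F G \<epsilon>0 \<epsilon> \<delta> D1 \<and>
             (\<epsilon> \<le> \<epsilon>0 / 2 \<and> \<delta> \<le> 1 / 2 \<longrightarrow>
                real (assg_iterations G \<epsilon>0 \<epsilon> \<delta> D1)
                  \<le> C * ln (1 / assg_delta \<epsilon>0 \<epsilon> \<delta>) * ln (\<epsilon>0 / \<epsilon>)) \<and>
             (\<epsilon> \<le> \<epsilon>0 / 2 \<and> \<delta> \<le> 1 / 2 \<and> ln (real (assg_K \<epsilon>0 \<epsilon>)) \<le> a * ln (1 / \<delta>) \<longrightarrow>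
                real (assg_iterations G \<epsilon>0 \<epsilon> \<delta> D1) \<le> C * ln (1 / \<delta>) * ln (\<epsilon>0 / \<epsilon>))"
    proof (intro exI[of _ "C0 * (1 + a)"] conjI allI impI; (elim conjE)?)
      show "0 < C0 * (1 + a)" using C0 *(6) by simp
    next
      fix \<epsilon> \<epsilon>0 \<delta> D1 :: real
      assume "0 < \<epsilon>" "\<epsilon> < \<epsilon>0" "0 < \<delta>" "\<delta> < 1" "c * \<epsilon>0 \<le> D1"
      then show "assg_succeeds TYPE('b) TYPE('c) F G \<epsilon>0 \<epsilon> \<delta> D1"
        using *(2,4) by (intro assg_succeeds_of_growth[OF assms(7) growth])
    next
      fix \<epsilon> \<epsilon>0 \<delta> D1 :: real
      assume p: "0 < \<epsilon>" "\<epsilon> < \<epsilon>0" "0 < \<delta>" "c * \<epsilon>0 \<le> D1" "D1 \<le> b * (c * \<epsilon>0)" "\<epsilon> \<le> \<epsilon>0 / 2" "\<delta> \<le> 1 / 2"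
      let ?K = "assg_K \<epsilon>0 \<epsilon>" and ?L = "ln (1 / assg_delta \<epsilon>0 \<epsilon> \<delta>)" and ?l = "ln (\<epsilon>0 / \<epsilon>)"
      let ?T = "real (assg_iterations G \<epsilon>0 \<epsilon> \<delta> D1)"
      have "0 < c * \<epsilon>0" using p(1,2) *(2) by simp
      then have T: "?T \<le> C0 * ?L * ?l"
        unfolding C0_def using p by (intro assg_iterations_le) auto
      have K: "1 \<le> real ?K" using assg_K_bounds(1)[OF p(1,2)] by simp
      have l: "0 \<le> ?l" using p(1,2) by simp
      have L_eq: "?L = ln (real ?K) + ln (1 / \<delta>)"
        using K p(3) by (simp add: assg_delta_def ln_div)
      have "0 \<le> ?L" using K p(3,7) by (simp add: L_eq)
      then have "0 \<le> a * (C0 * ?L * ?l)" using *(6) C0 l by simp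
      with T show "?T \<le> C0 * (1 + a) * ?L * ?l" by (simp add: algebra_simps)
      assume "ln (real ?K) \<le> a * ln (1 / \<delta>)"
      then have "?L \<le> (1 + a) * ln (1 / \<delta>)" by (simp add: L_eq algebra_simps)
      then have "C0 * ?L * ?l \<le> C0 * ((1 + a) * ln (1 / \<delta>)) * ?l"
        using C0 l by (intro mult_right_mono mult_left_mono) auto
      with T show "?T \<le> C0 * (1 + a) * ln (1 / \<delta>) * ?l" by (simp add: mult.assoc)
    qed
  qed
qed

end
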